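(* Let $\mathcal{G}$ be a decomposable, smooth, minor-closed class of graphs whose exponential generating function $G(z)=\sum_{n\ge0}|\mathcal{G}_n|z^n/n!$ has radius of convergence $\rho$ and satisfies $G(\rho)=\infty$, and let $G_n$ be uniform on $\mathcal{G}_n$. Then there is a family $\Phi$ of first-order sentences such that $\lim_{n\to\infty}\Pr(G_n\models\varphi)$ exists for every $\varphi\in\Phi$ and \[\overline{\{\lim_{n\to\infty}\Pr(G_n\models\varphi):\varphi\in\Phi\}}=[0,1].\]
   Context: $\mathcal{G}_n$ is the set of graphs in $\mathcal{G}$ with vertex set $\{1,\dots,n\}$. Minor-closed: closed under minors. Decomposable: a graph is in $\mathcal{G}$ iff all its components are. Smooth: $\lim_{n\to\infty} n|\mathcal{G}_{n-1}|/|\mathcal{G}_n|$ exists and is finite. First-order sentences are in the language of graphs with $=$ and adjacency. The bar denotes topological closure in $\mathbb{R}$. *)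

theory Defs
  imports "HOL-Analysis.Analysis" "HOL-Probability.Probability"
begin

text \<open>Finite simple graphs are pairs of a vertex set and a set of two-element sets of vertices.
  The null graph is allowed.\<close>

type_synonym 'a graph = "'a set \<times> 'a set set"

abbreviation verts :: "'a graph \<Rightarrow> 'a set" where "verts \<equiv> fst"
abbreviation edges :: "'a graph \<Rightarrow> 'a set set" where "edges \<equiv> snd"

definition simple_graph :: "'a graph \<Rightarrow> bool" where
  "simple_graph G \<longleftrightarrow> finite (verts G) \<and> (\<forall>e\<in>edges G. e \<subseteq> verts G \<and> card e = 2)"

definition graph_iso :: "'a graph \<Rightarrow> 'b graph \<Rightarrow> bool" where
  "graph_iso G H \<longleftrightarrow> (\<exists>f. bij_betw f (verts G) (verts H) \<and> edges H = (\<lambda>e. f ` e) ` edges G)"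

definition delete_vertex :: "'a graph \<Rightarrow> 'a \<Rightarrow> 'a graph" where
  "delete_vertex G v = (verts G - {v}, {e \<in> edges G. v \<notin> e})"

definition delete_edge :: "'a graph \<Rightarrow> 'a set \<Rightarrow> 'a graph" where
  "delete_edge G e = (verts G, edges G - {e})"

text \<open>Contraction of the edge \<open>{u, v}\<close> identifies \<open>v\<close> with \<open>u\<close>; the loop that arises is
  discarded (cardinality condition) and parallel edges are merged (edges form a set).\<close>

definition contract_edge :: "'a graph \<Rightarrow> 'a \<Rightarrow> 'a \<Rightarrow> 'a graph" where
  "contract_edge G u v =
     (let f = (\<lambda>x. if x = v then u else x)
      in (verts G - {v}, {f ` e |e. e \<in> edges G \<and> card (f ` e) = 2}))"

inductive reduces_to :: "'a graph \<Rightarrow> 'a graph \<Rightarrow> bool" for G where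
  refl: "reduces_to G G"
| delete_vertex: "reduces_to G H \<Longrightarrow> v \<in> verts H \<Longrightarrow> reduces_to G (delete_vertex H v)"
| delete_edge: "reduces_to G H \<Longrightarrow> e \<in> edges H \<Longrightarrow> reduces_to G (delete_edge H e)"
| contract_edge: "reduces_to G H \<Longrightarrow> {u, v} \<in> edges H \<Longrightarrow> reduces_to G (contract_edge H u v)"

definition minor_of :: "'b graph \<Rightarrow> 'a graph \<Rightarrow> bool" where
  "minor_of H G \<longleftrightarrow> (\<exists>H'. reduces_to G H' \<and> graph_iso H' H)"

definition induced_subgraph :: "'a graph \<Rightarrow> 'a set \<Rightarrow> 'a graph" where
  "induced_subgraph G W = (verts G \<inter> W, {e \<in> edges G. e \<subseteq> W})"

definition adj_rel :: "'a graph \<Rightarrow> ('a \<times> 'a) set" where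
  "adj_rel G = {(x, y). {x, y} \<in> edges G}"

definition graph_components :: "'a graph \<Rightarrow> 'a graph set" where
  "graph_components G = (\<lambda>v. induced_subgraph G {w. (v, w) \<in> (adj_rel G)\<^sup>*}) ` verts G"

text \<open>Up to isomorphism every finite graph has vertices in the natural numbers, so an
  isomorphism-closed class of finite graphs is represented by its members on finite sets of
  natural numbers.\<close>

definition graph_class :: "nat graph set \<Rightarrow> bool" where
  "graph_class \<G> \<longleftrightarrow>
     (\<forall>G\<in>\<G>. simple_graph G) \<and> (\<forall>G\<in>\<G>. \<forall>H::nat graph. graph_iso G H \<longrightarrow> H \<in> \<G>)"

definition minor_closed :: "nat graph set \<Rightarrow> bool" where
  "minor_closed \<G> \<longleftrightarrow> (\<forall>G\<in>\<G>. \<forall>H::nat graph. minor_of H G \<longrightarrow> H \<in> \<G>)"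

text \<open>The null graph has no components, hence belongs to every decomposable class.\<close>

definition decomposable :: "nat graph set \<Rightarrow> bool" where
  "decomposable \<G> \<longleftrightarrow>
     (\<forall>G. simple_graph G \<longrightarrow> (G \<in> \<G> \<longleftrightarrow> (\<forall>C\<in>graph_components G. C \<in> \<G>)))"

definition labelled :: "nat graph set \<Rightarrow> nat \<Rightarrow> nat graph set" where
  "labelled \<G> n = {G \<in> \<G>. verts G = {1..n}}"

text \<open>The first conjunct says that the quotients are eventually defined; without it, division by
  zero would make every class with no large graphs smooth.\<close>

definition smooth :: "nat graph set \<Rightarrow> bool" where
  "smooth \<G> \<longleftrightarrow>
     (\<forall>\<^sub>F n in sequentially. card (labelled \<G> n) \<noteq> 0) \<and>
     convergent (\<lambda>n. real n * real (card (labelled \<G> (n - 1))) / real (card (labelled \<G> n)))"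

definition egf :: "nat graph set \<Rightarrow> real fps" where
  "egf \<G> = Abs_fps (\<lambda>n. real (card (labelled \<G> n)) / fact n)"

text \<open>First-order formulas in the language of graphs, with variables named by natural numbers.\<close>

datatype fo =
    Eq nat nat
  | Adj nat nat
  | Neg fo
  | Conj fo fo
  | Exists nat fo

fun free_vars :: "fo \<Rightarrow> nat set" where
  "free_vars (Eq x y) = {x, y}"
| "free_vars (Adj x y) = {x, y}"
| "free_vars (Neg \<phi>) = free_vars \<phi>"
| "free_vars (Conj \<phi> \<psi>) = free_vars \<phi> \<union> free_vars \<psi>"
| "free_vars (Exists x \<phi>) = free_vars \<phi> - {x}"

definition sentence :: "fo \<Rightarrow> bool" where
  "sentence \<phi> \<longleftrightarrow> free_vars \<phi> = {}"

fun sat :: "'a graph \<Rightarrow> (nat \<Rightarrow> 'a) \<Rightarrow> fo \<Rightarrow> bool" where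
  "sat G s (Eq x y) \<longleftrightarrow> s x = s y"
| "sat G s (Adj x y) \<longleftrightarrow> {s x, s y} \<in> edges G"
| "sat G s (Neg \<phi>) \<longleftrightarrow> \<not> sat G s \<phi>"
| "sat G s (Conj \<phi> \<psi>) \<longleftrightarrow> sat G s \<phi> \<and> sat G s \<psi>"
| "sat G s (Exists x \<phi>) \<longleftrightarrow> (\<exists>a\<in>verts G. sat G (s(x := a)) \<phi>)"

text \<open>Assignments range over the whole type rather than the vertex set, so that truth in the null
  graph makes sense; for sentences the assignment is irrelevant.\<close>

definition models :: "'a graph \<Rightarrow> fo \<Rightarrow> bool" (infix "\<Turnstile>" 50) where
  "G \<Turnstile> \<phi> \<longleftrightarrow> (\<forall>s. sat G s \<phi>)"

lemma sat_cong_free_vars: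
  "(\<And>x. x \<in> free_vars \<phi> \<Longrightarrow> s x = t x) \<Longrightarrow> sat G s \<phi> \<longleftrightarrow> sat G t \<phi>"
proof (induction \<phi> arbitrary: s t)
  case (Eq x y)
  have "s x = t x" "s y = t y" by (rule Eq, simp)+
  then show ?case by simp
next
  case (Adj x y)
  have "s x = t x" "s y = t y" by (rule Adj, simp)+
  then show ?case by simp
next
  case (Neg \<phi>)
  have "sat G s \<phi> \<longleftrightarrow> sat G t \<phi>" by (rule Neg.IH, rule Neg.prems, simp)
  then show ?case by simp
next
  case (Conj \<phi> \<psi>)
  have "sat G s \<phi> \<longleftrightarrow> sat G t \<phi>" by (rule Conj.IH, rule Conj.prems, simp)
  moreover have "sat G s \<psi> \<longleftrightarrow> sat G t \<psi>" by (rule Conj.IH, rule Conj.prems, simp)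
  ultimately show ?case by simp
next
  case (Exists x \<phi>)
  have "sat G (s(x := a)) \<phi> \<longleftrightarrow> sat G (t(x := a)) \<phi>" for a
  proof (rule Exists.IH)
    fix y assume "y \<in> free_vars \<phi>"
    then show "(s(x := a)) y = (t(x := a)) y"
      by (cases "y = x") (simp_all add: Exists.prems)
  qed
  then show ?case by simp
qed

lemma models_sentence:
  assumes "sentence \<phi>"
  shows "G \<Turnstile> \<phi> \<longleftrightarrow> sat G s \<phi>"
proof -
  have "sat G t \<phi> \<longleftrightarrow> sat G s \<phi>" for t
    by (rule sat_cong_free_vars) (use assms in \<open>simp add: sentence_def\<close>)
  then show ?thesis unfolding models_def by blast
qed

lemma finite_labelled:
  assumes "graph_class \<G>"
  shows "finite (labelled \<G> n)"
proof (rule finite_subset)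
  show "labelled \<G> n \<subseteq> {{1..n}} \<times> Pow (Pow {1..n})"
  proof
    fix G assume G: "G \<in> labelled \<G> n"
    then have v: "verts G = {1..n}" and "simple_graph G"
      using assms by (simp_all add: labelled_def graph_class_def)
    then have "edges G \<subseteq> Pow {1..n}"
      unfolding simple_graph_def by blast
    with v show "G \<in> {{1..n}} \<times> Pow (Pow {1..n})"
      by (simp add: mem_Times_iff)
  qed
qed simp

text \<open>The probability that a uniformly random member of the class on \<open>{1..n}\<close> satisfies a
  sentence.\<close>

definition prob_models :: "nat graph set \<Rightarrow> fo \<Rightarrow> nat \<Rightarrow> real" where
  "prob_models \<G> \<phi> n = measure_pmf.prob (pmf_of_set (labelled \<G> n)) {G. G \<Turnstile> \<phi>}"

end

theory Submission
  imports Defs "HOL-Real_Asymp.Real_Asymp"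
begin

text \<open>Call a component small if it has at most \<open>k\<close> vertices. Having more than \<open>m\<close> small components
  is expressible by a first-order sentence, and the number of small components of a random member of
  the class is asymptotically Poisson: by smoothness its binomial moments converge, and Bonferroni's
  inequalities turn this into convergence of the point probabilities. The mean of the limit is
  \<open>\<Sum>j\<le>k. c\<^sub>j \<rho>\<^sup>j / j!\<close>, where \<open>c\<^sub>j\<close> counts the connected members on \<open>j\<close> labelled vertices;
  it tends to infinity with \<open>k\<close>, because otherwise the exponential formula would bound \<open>G(\<rho>)\<close>.
  The atoms of a Poisson distribution with large mean are small, so the values of the limiting
  distribution functions are dense in the unit interval.\<close>

section \<open>Components and their counts\<close>

text \<open>One identity drives the computation. Let X be the number of small components. Summing X
  * F(X - 1) over the class amounts to marking one small component, and decomposability lets the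
  marked component and the rest vary independently. After division by the number of graphs,
  smoothness turns this into a limit rule: the expectation of X * F(X - 1) tends to the mean times
  the limit of the expectation of F(X). With F a binomial coefficient the rule yields the binomial
  moments. With F the indicator of one value it passes from P(X = m) to P(X = m + 1), so Bonferroni
  is applied at zero only. Read as an inequality between partial sums at \<rho>, the same identity
  bounds G(\<rho>) by an exponential. The cutoff \<open>k\<close> has two jobs. First-order logic
  cannot express connectedness, but it can speak about adjacency-closed sets of at most
  \<open>k\<close> vertices. And with \<open>k\<close> fixed the marking identity has finitely many
  terms, so limits are taken term by term although the generating function diverges at
  \<rho>.\<close>

definition component :: "'a graph \<Rightarrow> 'a \<Rightarrow> 'a set" where
  "component G v = {w. (v, w) \<in> (adj_rel G)\<^sup>*}"

text \<open>Components are kept as vertex sets rather than graphs, so that a marked component is a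
  subset \<open>W\<close> of the vertices that can be summed over before the graph is
  chosen.\<close>

definition comp_sets :: "'a graph \<Rightarrow> 'a set set" where
  "comp_sets G = component G ` verts G"

definition small_components :: "nat \<Rightarrow> 'a graph \<Rightarrow> 'a set set" where
  "small_components k G = {W \<in> comp_sets G. card W \<le> k}"

definition num_small :: "nat \<Rightarrow> 'a graph \<Rightarrow> nat" where
  "num_small k G = card (small_components k G)"

definition graph_union :: "'a graph \<Rightarrow> 'a graph \<Rightarrow> 'a graph" where
  "graph_union G H = (verts G \<union> verts H, edges G \<union> edges H)"

definition map_graph :: "('a \<Rightarrow> 'b) \<Rightarrow> 'a graph \<Rightarrow> 'b graph" where
  "map_graph f G = (f ` verts G, (\<lambda>e. f ` e) ` edges G)"

definition members_on :: "nat graph set \<Rightarrow> nat set \<Rightarrow> nat graph set" where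
  "members_on \<G> V = {G \<in> \<G>. verts G = V}"

text \<open>Besides connectedness, \<open>V \<in> comp_sets G\<close> forces \<open>V\<close> to be
  nonempty. The null graph is thus not connected, and the terms for size 0 in all later sums
  vanish.\<close>

definition connected_on :: "nat graph set \<Rightarrow> nat set \<Rightarrow> nat graph set" where
  "connected_on \<G> V = {G \<in> \<G>. verts G = V \<and> V \<in> comp_sets G}"

lemma labelled_eq_members_on: "labelled \<G> n = members_on \<G> {1..n}"
  by (simp add: labelled_def members_on_def)

lemma graph_components_eq: "graph_components G = induced_subgraph G ` comp_sets G"
  by (auto simp: graph_components_def comp_sets_def component_def)

lemma sym_adj_rel: "sym (adj_rel G)"
  by (auto simp: sym_def adj_rel_def insert_commute)

lemma component_self: "v \<in> component G v"
  by (simp add: component_def)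

lemma component_eq:
  assumes "w \<in> component G v"
  shows "component G w = component G v"
proof -
  have vw: "(v, w) \<in> (adj_rel G)\<^sup>*" using assms by (simp add: component_def)
  then have "(w, v) \<in> (adj_rel G)\<^sup>*" using sym_adj_rel sym_rtrancl symD by metis
  with vw show ?thesis by (auto simp: component_def intro: rtrancl_trans)
qed

text \<open>The source of the upper bounds on components: it suffices to exhibit an adjacency-closed
  superset. The first-order description of components rests on the same principle.\<close>

lemma component_least:
  assumes "v \<in> Y" and closed: "\<And>y z. y \<in> Y \<Longrightarrow> {y, z} \<in> edges G \<Longrightarrow> z \<in> Y"
  shows "component G v \<subseteq> Y"
proof
  fix w assume "w \<in> component G v"
  then have "(v, w) \<in> (adj_rel G)\<^sup>*" by (simp add: component_def)
  then show "w \<in> Y"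
    by (induction rule: rtrancl_induct) (auto simp: adj_rel_def \<open>v \<in> Y\<close> intro: closed)
qed

lemma component_closed:
  assumes "y \<in> component G v" "{y, z} \<in> edges G"
  shows "z \<in> component G v"
  using assms by (auto simp: component_def adj_rel_def intro: rtrancl_into_rtrancl)

lemma edge_in_verts:
  assumes "simple_graph G" "{x, y} \<in> edges G"
  shows "x \<in> verts G" "y \<in> verts G"
  using assms by (auto simp: simple_graph_def)

lemma component_subset_verts:
  assumes "simple_graph G" "v \<in> verts G"
  shows "component G v \<subseteq> verts G"
  using assms(2) edge_in_verts(2)[OF assms(1)] by (rule component_least)

lemma components_subset_verts:
  assumes "simple_graph G" "W \<in> comp_sets G"
  shows "W \<subseteq> verts G"
  using assms component_subset_verts[OF assms(1)] unfolding comp_sets_def by blast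

lemma components_nonempty: "W \<in> comp_sets G \<Longrightarrow> W \<noteq> {}"
  unfolding comp_sets_def using component_self by (metis empty_iff imageE)

lemma component_of_mem: "W \<in> comp_sets G \<Longrightarrow> v \<in> W \<Longrightarrow> component G v = W"
  unfolding comp_sets_def using component_eq by (metis imageE)

lemma components_disjoint:
  "U \<in> comp_sets G \<Longrightarrow> W \<in> comp_sets G \<Longrightarrow> U \<noteq> W \<Longrightarrow> U \<inter> W = {}"
  by (metis component_of_mem disjoint_iff)

lemma finite_components: "simple_graph G \<Longrightarrow> finite (comp_sets G)"
  by (simp add: comp_sets_def simple_graph_def)

lemma finite_small_components: "simple_graph G \<Longrightarrow> finite (small_components k G)"
  by (simp add: small_components_def finite_components)

lemma simple_graph_induced: "simple_graph G \<Longrightarrow> simple_graph (induced_subgraph G W)"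
  by (auto simp: simple_graph_def induced_subgraph_def)

section \<open>Disjoint unions and decomposability\<close>

lemma simple_graph_union:
  "simple_graph G \<Longrightarrow> simple_graph H \<Longrightarrow> simple_graph (graph_union G H)"
  by (auto simp: simple_graph_def graph_union_def)

lemma graph_union_commute: "graph_union G H = graph_union H G"
  by (simp add: graph_union_def Un_commute)

lemma component_union_left:
  assumes "simple_graph G" "simple_graph H" "verts G \<inter> verts H = {}" "v \<in> verts G"
  shows "component (graph_union G H) v = component G v"
proof
  show "component (graph_union G H) v \<subseteq> component G v"
  proof (rule component_least)
    fix y z assume y: "y \<in> component G v" and e: "{y, z} \<in> edges (graph_union G H)"
    have "y \<in> verts G" using y component_subset_verts[OF assms(1,4)] by blast
    then have "{y, z} \<in> edges G"
      using e assms edge_in_verts[of H y z] by (auto simp: graph_union_def)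
    with y show "z \<in> component G v" by (rule component_closed)
  qed (rule component_self)
  show "component G v \<subseteq> component (graph_union G H) v"
    by (rule component_least) (auto simp: component_self graph_union_def intro: component_closed)
qed

lemma components_union:
  assumes "simple_graph G" "simple_graph H" "verts G \<inter> verts H = {}"
  shows "comp_sets (graph_union G H) = comp_sets G \<union> comp_sets H"
proof -
  have "component (graph_union G H) v = component H v" if "v \<in> verts H" for v
    using component_union_left[of H G v] assms that by (simp add: graph_union_commute Int_commute)
  then show ?thesis
    using component_union_left[OF assms]
    by (auto simp: comp_sets_def graph_union_def image_Un)
qed

lemma induced_union_left:
  assumes "simple_graph G" "simple_graph H" "verts G \<inter> verts H = {}" "W \<subseteq> verts G"
  shows "induced_subgraph (graph_union G H) W = induced_subgraph G W"
proof -
  have "e \<in> edges G" if "e \<in> edges H" "e \<subseteq> W" for e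
  proof -
    have "e \<subseteq> verts H" "card e = 2" using assms that by (auto simp: simple_graph_def)
    \<comment> \<open>An edge of \<open>H\<close> inside \<open>W\<close> would lie in both of the
      disjoint vertex sets.\<close>
    then have "e = {}" using that assms by blast
    with \<open>card e = 2\<close> show ?thesis by simp
  qed
  then show ?thesis using assms by (auto simp: induced_subgraph_def graph_union_def)
qed

lemma graph_components_union:
  assumes "simple_graph G" "simple_graph H" "verts G \<inter> verts H = {}"
  shows "graph_components (graph_union G H) = graph_components G \<union> graph_components H"
proof -
  have "induced_subgraph (graph_union G H) W = induced_subgraph G W" if "W \<in> comp_sets G" for W
    using induced_union_left[OF assms] that components_subset_verts assms by blast
  moreover have "induced_subgraph (graph_union G H) W = induced_subgraph H W" if "W \<in> comp_sets H" for W
    using induced_union_left[of H G W] components_subset_verts[OF assms(2) that] assms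
    by (simp add: graph_union_commute Int_commute)
  ultimately show ?thesis
    using components_union[OF assms] by (auto simp: graph_components_eq image_Un)
qed

lemma decomposable_union_iff:
  assumes "decomposable \<G>" "simple_graph G" "simple_graph H" "verts G \<inter> verts H = {}"
  shows "graph_union G H \<in> \<G> \<longleftrightarrow> G \<in> \<G> \<and> H \<in> \<G>"
proof -
  have mem: "K \<in> \<G> \<longleftrightarrow> (\<forall>C\<in>graph_components K. C \<in> \<G>)" if "simple_graph K" for K
    using assms(1) that unfolding decomposable_def by blast
  show ?thesis
    unfolding mem[OF assms(2)] mem[OF assms(3)] mem[OF simple_graph_union[OF assms(2,3)]]
      graph_components_union[OF assms(2-4)] by (rule ball_Un)
qed

section \<open>Cutting off one component\<close>

lemma split_component:
  assumes "simple_graph G" "W \<in> comp_sets G"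
  shows "graph_union (induced_subgraph G W) (induced_subgraph G (verts G - W)) = G"
proof (rule prod_eqI)
  show "fst (graph_union (induced_subgraph G W) (induced_subgraph G (verts G - W))) = fst G"
    by (auto simp: graph_union_def induced_subgraph_def)
  have "e \<subseteq> W \<or> e \<subseteq> verts G - W" if "e \<in> edges G" for e
  proof -
    have "e \<subseteq> verts G" "card e = 2" using assms that by (auto simp: simple_graph_def)
    then obtain x y where e: "e = {x, y}" by (auto simp: card_2_iff)
    obtain v where W: "W = component G v" using assms(2) by (auto simp: comp_sets_def)
    have "{x, y} \<in> edges G" "{y, x} \<in> edges G" using that by (simp_all add: e insert_commute)
    then have "x \<in> W \<longleftrightarrow> y \<in> W" unfolding W using component_closed by metis
    with e \<open>e \<subseteq> verts G\<close> show ?thesis by auto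
  qed
  then show "snd (graph_union (induced_subgraph G W) (induced_subgraph G (verts G - W))) = snd G"
    by (auto simp: graph_union_def induced_subgraph_def)
qed

lemma connected_components:
  assumes "simple_graph G" "verts G \<in> comp_sets G"
  shows "comp_sets G = {verts G}"
proof -
  have "W = verts G" if "W \<in> comp_sets G" for W
    using components_disjoint[OF that assms(2)] components_subset_verts[OF assms(1) that]
      components_nonempty[OF that] by blast
  with assms(2) show ?thesis by blast
qed

lemma num_small_union_connected:
  assumes "simple_graph G" "simple_graph H" "verts G \<inter> verts H = {}"
    and "verts G \<in> comp_sets G" "card (verts G) \<le> k"
  shows "num_small k (graph_union G H) = Suc (num_small k H)"
proof -
  have "small_components k (graph_union G H) = insert (verts G) (small_components k H)"
    using components_union[OF assms(1-3)] connected_components[OF assms(1,4)] assms(5)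
    by (auto simp: small_components_def)
  moreover have "verts G \<notin> comp_sets H"
    using components_subset_verts[OF assms(2)] components_nonempty[OF assms(4)] assms(3) by blast
  then have "verts G \<notin> small_components k H" by (simp add: small_components_def)
  ultimately show ?thesis using finite_small_components[OF assms(2)] by (simp add: num_small_def)
qed

text \<open>A graph is determined by its restrictions to a component and to the complement, since no
  edge crosses between them. Decomposability keeps both gluing and cutting inside the class.\<close>

lemma bij_betw_split:
  assumes cls: "graph_class \<G>" and dec: "decomposable \<G>" and "W \<subseteq> V"
  shows "bij_betw (\<lambda>(H, G). graph_union H G)
     (connected_on \<G> W \<times> members_on \<G> (V - W)) {G \<in> members_on \<G> V. W \<in> comp_sets G}"
proof (rule bij_betw_byWitness[where f' = "\<lambda>G. (induced_subgraph G W, induced_subgraph G (V - W))"])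
  have simple: "simple_graph G" if "G \<in> \<G>" for G using cls that by (simp add: graph_class_def)
  have inv1: "induced_subgraph (graph_union H G) W = H \<and> induced_subgraph (graph_union H G) (V - W) = G"
    if "H \<in> connected_on \<G> W" "G \<in> members_on \<G> (V - W)" for H G
  proof -
    have H: "simple_graph H" "verts H = W" and G: "simple_graph G" "verts G = V - W"
      using that simple by (auto simp: connected_on_def members_on_def)
    have ind: "induced_subgraph K (verts K) = K" if "simple_graph K" for K :: "nat graph"
      using that by (auto simp: induced_subgraph_def simple_graph_def intro!: prod_eqI)
    show ?thesis
      using induced_union_left[of H G W] induced_union_left[of G H "V - W"] H G ind[of H] ind[of G]
      by (simp add: graph_union_commute Int_commute)
  qed
  then show "\<forall>p\<in>connected_on \<G> W \<times> members_on \<G> (V - W).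
    (induced_subgraph (case p of (H, G) \<Rightarrow> graph_union H G) W,
     induced_subgraph (case p of (H, G) \<Rightarrow> graph_union H G) (V - W)) = p"
    by auto
  have "graph_union (induced_subgraph G W) (induced_subgraph G (V - W)) = G"
    if "G \<in> {G \<in> members_on \<G> V. W \<in> comp_sets G}" for G
    using that split_component[OF simple, of G W] by (auto simp: members_on_def)
  then show "\<forall>G\<in>{G \<in> members_on \<G> V. W \<in> comp_sets G}.
    (case (induced_subgraph G W, induced_subgraph G (V - W)) of (H, G) \<Rightarrow> graph_union H G) = G"
    unfolding prod.case by (rule ballI)
  show "(\<lambda>(H, G). graph_union H G) ` (connected_on \<G> W \<times> members_on \<G> (V - W))
     \<subseteq> {G \<in> members_on \<G> V. W \<in> comp_sets G}"
  proof (rule image_subsetI)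
    fix p assume "p \<in> connected_on \<G> W \<times> members_on \<G> (V - W)"
    then obtain H G where HG: "p = (H, G)"
      and H: "H \<in> \<G>" "verts H = W" "W \<in> comp_sets H" and G: "G \<in> \<G>" "verts G = V - W"
      by (auto simp: connected_on_def members_on_def)
    have "graph_union H G \<in> \<G>" using decomposable_union_iff[OF dec, of H G] simple H G by auto
    moreover have "W \<in> comp_sets (graph_union H G)"
      using components_union[of H G] simple H G by auto
    moreover have "verts (graph_union H G) = V"
      using H G \<open>W \<subseteq> V\<close> by (auto simp: graph_union_def)
    ultimately show "(case p of (H, G) \<Rightarrow> graph_union H G) \<in> {G \<in> members_on \<G> V. W \<in> comp_sets G}"
      by (simp add: members_on_def HG)
  qed
  show "(\<lambda>G. (induced_subgraph G W, induced_subgraph G (V - W))) ` {G \<in> members_on \<G> V. W \<in> comp_sets G}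
     \<subseteq> connected_on \<G> W \<times> members_on \<G> (V - W)"
  proof (rule image_subsetI)
    fix G assume "G \<in> {G \<in> members_on \<G> V. W \<in> comp_sets G}"
    then have G: "G \<in> \<G>" "verts G = V" "W \<in> comp_sets G" by (auto simp: members_on_def)
    define H where "H = induced_subgraph G W"
    define K where "K = induced_subgraph G (V - W)"
    have sG: "simple_graph G" using simple G by blast
    have sH: "simple_graph H" "simple_graph K"
      using sG by (simp_all add: H_def K_def simple_graph_induced)
    have v: "verts H = W" "verts K = V - W"
      using G \<open>W \<subseteq> V\<close> by (auto simp: H_def K_def induced_subgraph_def)
    have U: "graph_union H K = G" using split_component[OF sG] G by (simp add: H_def K_def)
    have "H \<in> \<G>" "K \<in> \<G>" using decomposable_union_iff[OF dec sH] G v by (auto simp: U)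
    \<comment> \<open>\<open>W\<close> is a component of \<open>H\<close> or of \<open>K\<close>;
      being nonempty and disjoint from the vertices of \<open>K\<close>, it cannot belong to the
      latter.\<close>
    moreover have "W \<in> comp_sets H"
      using components_union[OF sH] G v components_subset_verts[OF sH(2), of W]
        components_nonempty[OF G(3)] by (auto simp: U)
    ultimately show "(induced_subgraph G W, induced_subgraph G (V - W)) \<in> connected_on \<G> W \<times> members_on \<G> (V - W)"
      using v unfolding connected_on_def members_on_def H_def K_def by simp
  qed
qed

lemma finite_members_on:
  assumes "graph_class \<G>" "finite V"
  shows "finite (members_on \<G> V)"
proof (rule finite_subset)
  show "members_on \<G> V \<subseteq> {V} \<times> Pow (Pow V)"
    using assms by (fastforce simp: members_on_def graph_class_def simple_graph_def)
qed (use assms in simp)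

text \<open>Double counting of pairs of a graph and one of its small components. Removing the marked
  component lowers the count by one, which explains the argument \<open>num_small k G - 1\<close>;
  where this subtraction truncates, the factor \<open>num_small k G\<close> is zero.\<close>

lemma sum_mark_component:
  fixes F :: "nat \<Rightarrow> real"
  assumes cls: "graph_class \<G>" and dec: "decomposable \<G>" and "finite V"
  shows "(\<Sum>G\<in>members_on \<G> V. real (num_small k G) * F (num_small k G - 1)) =
    (\<Sum>W | W \<subseteq> V \<and> card W \<le> k. real (card (connected_on \<G> W)) *
       (\<Sum>G\<in>members_on \<G> (V - W). F (num_small k G)))"
proof -
  have simple: "simple_graph G" if "G \<in> \<G>" for G using cls that by (simp add: graph_class_def)
  have fin: "finite (members_on \<G> V)" using finite_members_on cls \<open>finite V\<close> by blast
  have finW: "finite {W. W \<subseteq> V \<and> card W \<le> k}" using \<open>finite V\<close> by simp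
  have small: "small_components k G = {W. (W \<subseteq> V \<and> card W \<le> k) \<and> W \<in> comp_sets G}"
    if "G \<in> members_on \<G> V" for G
    using that components_subset_verts[OF simple, of G]
    unfolding small_components_def members_on_def by blast
  have "(\<Sum>G\<in>members_on \<G> V. real (num_small k G) * F (num_small k G - 1)) =
     (\<Sum>G\<in>members_on \<G> V. \<Sum>W\<in>{W. W \<subseteq> V \<and> card W \<le> k} \<inter> comp_sets G. F (num_small k G - 1))"
    by (rule sum.cong) (auto simp: num_small_def small Collect_conj_eq Int_assoc)
  also have "\<dots> = (\<Sum>G\<in>members_on \<G> V. \<Sum>W | W \<subseteq> V \<and> card W \<le> k.
      if W \<in> comp_sets G then F (num_small k G - 1) else 0)"
    by (intro sum.cong[OF HOL.refl] sum.inter_restrict[OF finW])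
  also have "\<dots> = (\<Sum>W | W \<subseteq> V \<and> card W \<le> k. \<Sum>G\<in>members_on \<G> V.
      if W \<in> comp_sets G then F (num_small k G - 1) else 0)"
    by (rule sum.swap)
  also have "\<dots> = (\<Sum>W | W \<subseteq> V \<and> card W \<le> k. real (card (connected_on \<G> W)) *
       (\<Sum>G\<in>members_on \<G> (V - W). F (num_small k G)))"
  proof (rule sum.cong[OF HOL.refl])
    fix W assume W: "W \<in> {W. W \<subseteq> V \<and> card W \<le> k}"
    have "(\<Sum>G\<in>members_on \<G> V. if W \<in> comp_sets G then F (num_small k G - 1) else 0) =
       (\<Sum>G | G \<in> members_on \<G> V \<and> W \<in> comp_sets G. F (num_small k G - 1))"
      using fin by (simp add: sum.If_cases Collect_conj_eq Int_commute)
    also have "\<dots> = (\<Sum>p\<in>connected_on \<G> W \<times> members_on \<G> (V - W).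
        F (num_small k (case p of (H, G) \<Rightarrow> graph_union H G) - 1))"
      using sum.reindex_bij_betw[OF bij_betw_split[OF cls dec], of W V "\<lambda>G. F (num_small k G - 1)"] W
      by simp
    also have "\<dots> = (\<Sum>p\<in>connected_on \<G> W \<times> members_on \<G> (V - W). F (num_small k (snd p)))"
    proof (rule sum.cong[OF HOL.refl], clarsimp)
      fix H1 H2 G1 G2
      assume "(H1, H2) \<in> connected_on \<G> W" "(G1, G2) \<in> members_on \<G> (V - W)"
      then have "num_small k (graph_union (H1, H2) (G1, G2)) = Suc (num_small k (G1, G2))"
        using W by (intro num_small_union_connected) (auto simp: connected_on_def members_on_def simple)
      then show "F (num_small k (graph_union (H1, H2) (G1, G2)) - Suc 0) = F (num_small k (G1, G2))"
        by simp
    qed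
    also have "\<dots> = (\<Sum>H\<in>connected_on \<G> W. \<Sum>G\<in>members_on \<G> (V - W). F (num_small k G))"
      unfolding sum.cartesian_product by (simp only: case_prod_unfold)
    finally show "(\<Sum>G\<in>members_on \<G> V. if W \<in> comp_sets G then F (num_small k G - 1) else 0) =
      real (card (connected_on \<G> W)) * (\<Sum>G\<in>members_on \<G> (V - W). F (num_small k G))"
      by simp
  qed
  finally show ?thesis .
qed

section \<open>Invariance under relabelling\<close>

lemma simple_graph_map:
  assumes "simple_graph G" "inj_on f (verts G)"
  shows "simple_graph (map_graph f G)"
proof -
  have "f ` e \<subseteq> f ` verts G \<and> card (f ` e) = 2" if "e \<in> edges G" for e
  proof -
    have "e \<subseteq> verts G" "card e = 2" using assms(1) that by (auto simp: simple_graph_def)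
    then show ?thesis using inj_on_subset[OF assms(2)] by (auto simp: card_image)
  qed
  then show ?thesis using assms(1) by (auto simp: simple_graph_def map_graph_def)
qed

lemma map_graph_id:
  assumes "simple_graph G" "\<And>v. v \<in> verts G \<Longrightarrow> g (f v) = v"
  shows "map_graph g (map_graph f G) = G"
proof (rule prod_eqI)
  have "(\<lambda>x. g (f x)) ` e = e" if "e \<subseteq> verts G" for e
    using that assms(2) by force
  then show "fst (map_graph g (map_graph f G)) = fst G"
    "snd (map_graph g (map_graph f G)) = snd G"
    using assms(1) by (force simp: map_graph_def image_image simple_graph_def)+
qed

text \<open>Paths map to paths. The inclusion is applied once to \<open>f\<close> and once to its
  left inverse to obtain equality in \<open>component_map\<close>.\<close>

lemma component_map_subset: "f ` component G v \<subseteq> component (map_graph f G) (f v)"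
proof (rule image_subsetI)
  fix w assume "w \<in> component G v"
  then have "(v, w) \<in> (adj_rel G)\<^sup>*" by (simp add: component_def)
  then have "(f v, f w) \<in> (adj_rel (map_graph f G))\<^sup>*"
  proof (induction rule: rtrancl_induct)
    case (step y z)
    then have "(f y, f z) \<in> adj_rel (map_graph f G)"
      using image_eqI[of "f ` {y, z}" "\<lambda>e. f ` e" "{y, z}" "edges G"]
      by (simp add: adj_rel_def map_graph_def)
    with step.IH show ?case by (rule rtrancl_into_rtrancl)
  qed simp
  then show "f w \<in> component (map_graph f G) (f v)" by (simp add: component_def)
qed

lemma component_map:
  assumes "simple_graph G" "inj_on f (verts G)" "v \<in> verts G"
  shows "component (map_graph f G) (f v) = f ` component G v"
proof
  define g where "g = inv_into (verts G) f"
  have g: "g (f u) = u" if "u \<in> verts G" for u using assms that by (simp add: g_def)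
  show "component (map_graph f G) (f v) \<subseteq> f ` component G v"
  proof
    fix w assume w: "w \<in> component (map_graph f G) (f v)"
    then have "w \<in> verts (map_graph f G)"
      using component_subset_verts[OF simple_graph_map[OF assms(1,2)], of "f v"] assms(3)
      by (auto simp: map_graph_def)
    then have "f (g w) = w" by (auto simp: map_graph_def g)
    moreover have "g w \<in> component G v"
      using component_map_subset[of g "map_graph f G" "f v"] w map_graph_id[of G g f, OF assms(1) g] g assms(3)
      by auto
    ultimately show "w \<in> f ` component G v" by force
  qed
qed (rule component_map_subset)

lemma components_map:
  assumes "simple_graph G" "inj_on f (verts G)"
  shows "comp_sets (map_graph f G) = (\<lambda>W. f ` W) ` comp_sets G"
proof -
  have "verts (map_graph f G) = f ` verts G" by (simp add: map_graph_def)
  then show ?thesis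
    unfolding comp_sets_def by (simp add: image_image component_map[OF assms])
qed

lemma num_small_map:
  assumes "simple_graph G" "inj_on f (verts G)"
  shows "num_small k (map_graph f G) = num_small k G"
proof -
  have card: "card (f ` W) = card W" if "W \<in> comp_sets G" for W
    using components_subset_verts[OF assms(1) that] assms(2) by (metis card_image inj_on_subset)
  have "small_components k (map_graph f G) = (\<lambda>W. f ` W) ` small_components k G"
    using components_map[OF assms] card by (auto simp: small_components_def)
  moreover have "inj_on (\<lambda>W. f ` W) (small_components k G)"
    using components_subset_verts[OF assms(1)] inj_on_image_Pow[OF assms(2)]
    by (auto simp: small_components_def intro: inj_on_subset)
  ultimately show ?thesis by (simp add: num_small_def card_image)
qed

lemma map_graph_in_class:
  assumes "graph_class \<G>" "G \<in> \<G>" "inj_on f (verts G)"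
  shows "map_graph f G \<in> \<G>"
proof -
  have "graph_iso G (map_graph f G)"
    using assms by (auto simp: graph_iso_def map_graph_def bij_betw_def intro!: exI[of _ f])
  then show ?thesis using assms unfolding graph_class_def by blast
qed

text \<open>Makes the counts depend only on the size of the vertex set, so that members on
  \<open>V - W\<close> can be replaced by labelled members on an initial segment.\<close>

lemma bij_betw_relabel:
  assumes cls: "graph_class \<G>" and f: "bij_betw f U V"
  shows "bij_betw (map_graph f) (members_on \<G> U) (members_on \<G> V)"
    and "bij_betw (map_graph f) (connected_on \<G> U) (connected_on \<G> V)"
proof -
  define g where "g = inv_into U f"
  have simple: "simple_graph G" if "G \<in> \<G>" for G using cls that by (simp add: graph_class_def)
  have g: "bij_betw g V U" using f by (simp add: g_def bij_betw_inv_into)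
  have gf: "g (f x) = x" if "x \<in> U" for x using f that by (simp add: g_def bij_betw_inv_into_left)
  have fg: "f (g x) = x" if "x \<in> V" for x using f that by (simp add: g_def bij_betw_inv_into_right)
  have members: "map_graph h G \<in> members_on \<G> B" if "bij_betw h A B" "G \<in> members_on \<G> A" for h A B G
    using that map_graph_in_class[OF cls, of G h]
    by (auto simp: members_on_def bij_betw_def map_graph_def)
  have conn: "map_graph h G \<in> connected_on \<G> B" if h: "bij_betw h A B" and G: "G \<in> connected_on \<G> A" for h A B G
  proof -
    have *: "G \<in> \<G>" "verts G = A" "A \<in> comp_sets G" using G by (auto simp: connected_on_def)
    have inj: "inj_on h (verts G)" and B: "h ` A = B" using h * by (auto simp: bij_betw_def)
    have "map_graph h G \<in> members_on \<G> B" using members[OF h] * by (simp add: members_on_def)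
    moreover have "B \<in> comp_sets (map_graph h G)"
      using components_map[OF simple[OF *(1)] inj] * B by auto
    ultimately show ?thesis by (simp add: members_on_def connected_on_def)
  qed
  have inv: "map_graph g (map_graph f G) = G" if "G \<in> \<G>" "verts G = U" for G
    by (rule map_graph_id) (use simple gf that in auto)
  have inv': "map_graph f (map_graph g G) = G" if "G \<in> \<G>" "verts G = V" for G
    by (rule map_graph_id) (use simple fg that in auto)
  show "bij_betw (map_graph f) (members_on \<G> U) (members_on \<G> V)"
    by (rule bij_betw_byWitness[where f' = "map_graph g"])
      (use members[OF f] members[OF g] inv inv' in \<open>auto simp: members_on_def\<close>)
  show "bij_betw (map_graph f) (connected_on \<G> U) (connected_on \<G> V)"
    by (rule bij_betw_byWitness[where f' = "map_graph g"])
      (use conn[OF f] conn[OF g] inv inv' in \<open>auto simp: connected_on_def\<close>)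
qed

lemma card_connected_on:
  assumes "graph_class \<G>" "finite W"
  shows "card (connected_on \<G> W) = card (connected_on \<G> {1..card W})"
proof -
  obtain f where "bij_betw f W {1..card W}"
    using finite_same_card_bij[OF assms(2), of "{1..card W}"] by auto
  then show ?thesis using bij_betw_relabel(2)[OF assms(1)] bij_betw_same_card by blast
qed

lemma sum_members_on:
  assumes "graph_class \<G>" "finite U"
  shows "(\<Sum>G\<in>members_on \<G> U. F (num_small k G)) = (\<Sum>G\<in>labelled \<G> (card U). F (num_small k G))"
proof -
  obtain f where f: "bij_betw f U {1..card U}"
    using finite_same_card_bij[OF assms(2), of "{1..card U}"] by auto
  have "(\<Sum>G\<in>labelled \<G> (card U). F (num_small k G)) =
      (\<Sum>G\<in>members_on \<G> U. F (num_small k (map_graph f G)))"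
    unfolding labelled_eq_members_on
    by (rule sum.reindex_bij_betw[OF bij_betw_relabel(1)[OF assms(1) f], symmetric])
  also have "\<dots> = (\<Sum>G\<in>members_on \<G> U. F (num_small k G))"
    using f assms(1)
    by (intro sum.cong HOL.refl) (auto simp: num_small_map members_on_def graph_class_def bij_betw_def)
  finally show ?thesis by simp
qed

text \<open>Group the marked sets by size; the binomial coefficient counts the sets of size
  \<open>j\<close>. For \<open>j > n\<close> it is zero, which disposes of the truncated
  \<open>n - j\<close>.\<close>

lemma sum_labelled_mark:
  fixes F :: "nat \<Rightarrow> real"
  assumes cls: "graph_class \<G>" and dec: "decomposable \<G>"
  shows "(\<Sum>G\<in>labelled \<G> n. real (num_small k G) * F (num_small k G - 1)) =
    (\<Sum>j\<le>k. real (n choose j) * real (card (connected_on \<G> {1..j})) *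
       (\<Sum>G\<in>labelled \<G> (n - j). F (num_small k G)))"
proof -
  define h where "h j = real (card (connected_on \<G> {1..j})) *
       (\<Sum>G\<in>labelled \<G> (n - j). F (num_small k G))" for j
  have "(\<Sum>G\<in>labelled \<G> n. real (num_small k G) * F (num_small k G - 1)) =
     (\<Sum>W | W \<subseteq> {1..n} \<and> card W \<le> k. h (card W))"
    unfolding labelled_eq_members_on[of \<G> n] sum_mark_component[OF assms finite_atLeastAtMost] h_def
  proof (rule sum.cong[OF HOL.refl])
    fix W assume "W \<in> {W. W \<subseteq> {1..n} \<and> card W \<le> k}"
    then have W: "W \<subseteq> {1..n}" "finite W" using finite_subset by auto
    then have "card ({1..n} - W) = n - card W" by (simp add: card_Diff_subset)
    then show "real (card (connected_on \<G> W)) * (\<Sum>G\<in>members_on \<G> ({1..n} - W). F (num_small k G)) =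
      real (card (connected_on \<G> {1..card W})) * (\<Sum>G\<in>labelled \<G> (n - card W). F (num_small k G))"
      using sum_members_on[OF cls, of "{1..n} - W" F k] card_connected_on[OF cls W(2)] by simp
  qed
  also have "\<dots> = (\<Sum>j\<le>k. \<Sum>W\<in>{W \<in> {W. W \<subseteq> {1..n} \<and> card W \<le> k}. card W = j}. h (card W))"
    by (rule sum.group[symmetric]) auto
  also have "\<dots> = (\<Sum>j\<le>k. \<Sum>W | W \<subseteq> {1..n} \<and> card W = j. h j)"
    by (intro sum.cong) auto
  also have "\<dots> = (\<Sum>j\<le>k. real (n choose j) * h j)"
    using n_subsets[of "{1..n}"] by simp
  finally show ?thesis by (simp add: h_def mult.assoc)
qed

section \<open>First-order description of small components\<close>

text \<open>The unit of conjunction must be closed, so the variable of \<open>Eq 0 0\<close> is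
  bound; the universal form keeps it true in the null graph.\<close>

definition fo_true :: fo where
  "fo_true = Neg (Exists 0 (Neg (Eq 0 0)))"

definition conjs :: "fo list \<Rightarrow> fo" where
  "conjs \<phi>s = foldr Conj \<phi>s fo_true"

definition exs :: "nat list \<Rightarrow> fo \<Rightarrow> fo" where
  "exs xs \<phi> = foldr Exists xs \<phi>"

lemma sat_conjs: "sat G s (conjs \<phi>s) \<longleftrightarrow> (\<forall>\<phi>\<in>set \<phi>s. sat G s \<phi>)"
  by (induction \<phi>s) (auto simp: conjs_def fo_true_def)

lemma free_vars_conjs: "free_vars (conjs \<phi>s) = (\<Union>\<phi>\<in>set \<phi>s. free_vars \<phi>)"
  by (induction \<phi>s) (auto simp: conjs_def fo_true_def)

lemma free_vars_exs: "free_vars (exs xs \<phi>) = free_vars \<phi> - set xs"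
  by (induction xs) (auto simp: exs_def)

lemma sat_exs:
  "sat G s (exs xs \<phi>) \<longleftrightarrow> (\<exists>t. t ` set xs \<subseteq> verts G \<and> sat G (override_on s t (set xs)) \<phi>)"
proof (induction xs arbitrary: s)
  case Nil
  then show ?case by (simp add: exs_def)
next
  case (Cons x xs)
  have "sat G s (exs (x # xs) \<phi>) \<longleftrightarrow> (\<exists>a\<in>verts G. \<exists>t. t ` set xs \<subseteq> verts G \<and>
      sat G (override_on (s(x := a)) t (set xs)) \<phi>)"
    using Cons.IH[unfolded exs_def] by (simp only: exs_def foldr.simps o_apply sat.simps)
  also have "\<dots> \<longleftrightarrow> (\<exists>t. t ` set (x # xs) \<subseteq> verts G \<and> sat G (override_on s t (set (x # xs))) \<phi>)"
  proof
    assume "\<exists>a\<in>verts G. \<exists>t. t ` set xs \<subseteq> verts G \<and> sat G (override_on (s(x := a)) t (set xs)) \<phi>"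
    then obtain a t where *: "a \<in> verts G" "t ` set xs \<subseteq> verts G"
      "sat G (override_on (s(x := a)) t (set xs)) \<phi>" by blast
    \<comment> \<open>If \<open>x\<close> recurs in \<open>xs\<close>, the inner quantifier
      overrides the outer choice \<open>a\<close>.\<close>
    let ?t = "if x \<in> set xs then t else t(x := a)"
    have "override_on s ?t (set (x # xs)) = override_on (s(x := a)) t (set xs)"
      by (auto simp: override_on_def fun_eq_iff)
    moreover have "?t ` set (x # xs) \<subseteq> verts G" using * by auto
    ultimately show "\<exists>t. t ` set (x # xs) \<subseteq> verts G \<and> sat G (override_on s t (set (x # xs))) \<phi>"
      using *(3) by (intro exI[of _ ?t]) simp
  next
    assume "\<exists>t. t ` set (x # xs) \<subseteq> verts G \<and> sat G (override_on s t (set (x # xs))) \<phi>"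
    then obtain t where *: "t ` set (x # xs) \<subseteq> verts G" "sat G (override_on s t (set (x # xs))) \<phi>"
      by blast
    have "override_on (s(x := t x)) t (set xs) = override_on s t (set (x # xs))"
      by (auto simp: override_on_def fun_eq_iff)
    then show "\<exists>a\<in>verts G. \<exists>t. t ` set xs \<subseteq> verts G \<and> sat G (override_on (s(x := a)) t (set xs)) \<phi>"
      using * by (intro bexI[of _ "t x"] exI[of _ t]) auto
  qed
  finally show ?case .
qed

text \<open>Variables \<open>0, \<dots>, m - 1\<close> are the representatives of the components, variables
  \<open>m, \<dots>, m + k - 1\<close> enumerate (with repetitions) a set containing the component of the
  representative \<open>i\<close>, and \<open>m + k\<close> ranges over the neighbours of that set.\<close>

definition covered :: "nat \<Rightarrow> nat \<Rightarrow> nat \<Rightarrow> fo" where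
  "covered k m i = exs [m..<m + k]
     (Conj (Neg (conjs (map (\<lambda>y. Neg (Eq y i)) [m..<m + k])))
        (conjs (map (\<lambda>y. Conj (conjs (map (\<lambda>j. Neg (Eq y j)) (filter (\<lambda>j. j \<noteq> i) [0..<m])))
            (Neg (Exists (m + k) (Conj (Adj y (m + k))
               (conjs (map (\<lambda>x. Neg (Eq (m + k) x)) [m..<m + k])))))) [m..<m + k])))"

text \<open>No inequalities between the representatives are stated: \<open>covered\<close> already
  keeps every other representative out of the set around \<open>i\<close>.\<close>

definition many_small :: "nat \<Rightarrow> nat \<Rightarrow> fo" where
  "many_small k m = exs [0..<m] (conjs (map (covered k m) [0..<m]))"

lemma sentence_many_small: "sentence (many_small k m)"
proof -
  have "free_vars (covered k m i) \<subseteq> {0..<m}" if "i < m" for i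
    using that by (auto simp: covered_def free_vars_exs free_vars_conjs split: if_splits)
  then show ?thesis
    unfolding sentence_def many_small_def free_vars_exs free_vars_conjs set_map set_upt
    by (simp add: UN_subset_iff)
qed

definition closed_set :: "'a graph \<Rightarrow> 'a set \<Rightarrow> bool" where
  "closed_set G Y \<longleftrightarrow> (\<forall>y\<in>Y. \<forall>z. {y, z} \<in> edges G \<longrightarrow> z \<in> Y)"

text \<open>\<open>Y\<close> may be a union of several components: only closure under adjacency is
  expressed, and this suffices to trap the component of \<open>s i\<close> inside a set of at most
  \<open>k\<close> vertices.\<close>

lemma sat_covered:
  assumes G: "simple_graph G" and "i < m"
  shows "sat G s (covered k m i) \<longleftrightarrow>
    (\<exists>Y\<subseteq>verts G. card Y \<le> k \<and> s i \<in> Y \<and> (\<forall>j<m. j \<noteq> i \<longrightarrow> s j \<notin> Y) \<and> closed_set G Y)"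
proof -
  define P where "P Y \<longleftrightarrow> s i \<in> Y \<and> (\<forall>j<m. j \<noteq> i \<longrightarrow> s j \<notin> Y) \<and> closed_set G Y" for Y
  have "sat G s (covered k m i) \<longleftrightarrow> (\<exists>t. t ` {m..<m + k} \<subseteq> verts G \<and> P (t ` {m..<m + k}))"
    unfolding covered_def sat_exs set_upt
  proof (intro ex_cong1 conj_cong HOL.refl)
    fix t :: "nat \<Rightarrow> 'a"
    define u where "u = override_on s t {m..<m + k}"
    assume t: "t ` {m..<m + k} \<subseteq> verts G"
    have u1: "u y = t y" if "m \<le> y" "y < m + k" for y using that by (simp add: u_def override_on_def)
    have u2: "u j = s j" if "j < m" for j using that by (simp add: u_def override_on_def)
    have "(\<not> (\<forall>y\<in>{m..<m + k}. u y \<noteq> u i)) \<longleftrightarrow> s i \<in> t ` {m..<m + k}"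
      using u1 u2[OF \<open>i < m\<close>] by force
    moreover have "(\<forall>y\<in>{m..<m + k}. \<forall>j\<in>{j \<in> {0..<m}. j \<noteq> i}. u y \<noteq> u j) \<longleftrightarrow>
        (\<forall>j<m. j \<noteq> i \<longrightarrow> s j \<notin> t ` {m..<m + k})"
      using u1 u2 by force
    moreover have "(\<forall>y\<in>{m..<m + k}. \<not> (\<exists>z\<in>verts G. {u y, z} \<in> edges G \<and>
        (\<forall>x\<in>{m..<m + k}. z \<noteq> u x))) \<longleftrightarrow> closed_set G (t ` {m..<m + k})"
    proof -
      have "closed_set G (t ` {m..<m + k}) \<longleftrightarrow>
         (\<forall>y\<in>{m..<m + k}. \<forall>z. {t y, z} \<in> edges G \<longrightarrow> z \<in> t ` {m..<m + k})"
        unfolding closed_set_def by blast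
      also have "\<dots> \<longleftrightarrow> (\<forall>y\<in>{m..<m + k}. \<forall>z\<in>verts G. {t y, z} \<in> edges G \<longrightarrow> z \<in> t ` {m..<m + k})"
        using edge_in_verts(2)[OF G] by blast
      also have "\<dots> \<longleftrightarrow> (\<forall>y\<in>{m..<m + k}. \<not> (\<exists>z\<in>verts G. {u y, z} \<in> edges G \<and>
        (\<forall>x\<in>{m..<m + k}. z \<noteq> u x)))"
        using u1 by (intro ball_cong HOL.refl) (auto simp: image_iff)
      finally show ?thesis by blast
    qed
    ultimately show "sat G (override_on s t {m..<m + k})
     (Conj (Neg (conjs (map (\<lambda>y. Neg (Eq y i)) [m..<m + k])))
        (conjs (map (\<lambda>y. Conj (conjs (map (\<lambda>j. Neg (Eq y j)) (filter (\<lambda>j. j \<noteq> i) [0..<m])))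
            (Neg (Exists (m + k) (Conj (Adj y (m + k))
               (conjs (map (\<lambda>x. Neg (Eq (m + k) x)) [m..<m + k])))))) [m..<m + k]))) \<longleftrightarrow>
      P (t ` {m..<m + k})"
      unfolding P_def u_def[symmetric] by (simp add: sat_conjs ball_conj_distrib)
  qed
  also have "\<dots> \<longleftrightarrow> (\<exists>Y\<subseteq>verts G. card Y \<le> k \<and> P Y)"
  proof
    assume "\<exists>t. t ` {m..<m + k} \<subseteq> verts G \<and> P (t ` {m..<m + k})"
    then obtain t where t: "t ` {m..<m + k} \<subseteq> verts G" "P (t ` {m..<m + k})" by blast
    moreover have "card (t ` {m..<m + k}) \<le> k" using card_image_le[of "{m..<m + k}" t] by simp
    ultimately show "\<exists>Y\<subseteq>verts G. card Y \<le> k \<and> P Y" by blast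
  next
    assume "\<exists>Y\<subseteq>verts G. card Y \<le> k \<and> P Y"
    then obtain Y where Y: "Y \<subseteq> verts G" "card Y \<le> k" "P Y" by blast
    have "finite Y" using Y(1) G finite_subset by (auto simp: simple_graph_def)
    then obtain f where f: "bij_betw f {0..<card Y} Y" using ex_bij_betw_nat_finite by blast
    \<comment> \<open>Exactly \<open>k\<close> variables must enumerate \<open>Y\<close>; the
      surplus ones repeat \<open>s i\<close>, which lies in \<open>Y\<close>.\<close>
    define t where "t y = (if y - m < card Y then f (y - m) else s i)" for y
    have "t ` {m..<m + k} = Y"
    proof
      show "t ` {m..<m + k} \<subseteq> Y"
        using f Y(3) by (auto simp: t_def P_def bij_betw_def)
      show "Y \<subseteq> t ` {m..<m + k}"
      proof
        fix v assume "v \<in> Y"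
        then obtain n where n: "n < card Y" "f n = v" using f by (force simp: bij_betw_def)
        then have "t (m + n) = v" "m + n \<in> {m..<m + k}" using Y(2) by (auto simp: t_def)
        then show "v \<in> t ` {m..<m + k}" by blast
      qed
    qed
    with Y show "\<exists>t. t ` {m..<m + k} \<subseteq> verts G \<and> P (t ` {m..<m + k})" by blast
  qed
  finally show ?thesis by (simp add: P_def)
qed

text \<open>Given the sets \<open>Y i\<close>, the component of \<open>t i\<close> lies in
  \<open>Y i\<close>, hence is small, and it misses every other \<open>t j\<close>, hence the
  components are distinct. Conversely, distinct small components serve as the sets
  \<open>Y i\<close> themselves.\<close>

lemma many_small_iff:
  assumes G: "simple_graph G"
  shows "G \<Turnstile> many_small k m \<longleftrightarrow> m \<le> num_small k G"
proof -
  have fin: "finite Y" if "Y \<subseteq> verts G" for Y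
    using that G finite_subset by (auto simp: simple_graph_def)
  define Q where "Q t i Y \<longleftrightarrow> Y \<subseteq> verts G \<and> card Y \<le> k \<and> t i \<in> Y \<and>
     (\<forall>j<m. j \<noteq> i \<longrightarrow> t j \<notin> Y) \<and> closed_set G Y" for t :: "nat \<Rightarrow> 'a" and i Y
  have iff: "G \<Turnstile> many_small k m \<longleftrightarrow> (\<exists>t. (\<forall>i<m. t i \<in> verts G) \<and> (\<forall>i<m. \<exists>Y. Q t i Y))"
  proof -
    have ov: "override_on s t {0..<m} i = t i" if "i < m" for s t :: "nat \<Rightarrow> 'a" and i
      using that by (simp add: override_on_def)
    have "sat G (override_on s t {0..<m}) (covered k m i) \<longleftrightarrow> (\<exists>Y. Q t i Y)" if "i < m" for s t i
      unfolding sat_covered[OF G that] Q_def using that ov by (auto simp: ov)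
    then show ?thesis
      unfolding models_sentence[OF sentence_many_small, of G k m undefined]
      by (simp add: many_small_def sat_exs sat_conjs image_subset_iff) (simp add: Ball_def)
  qed
  show ?thesis
  proof
    assume "G \<Turnstile> many_small k m"
    then obtain t where t: "\<And>i. i < m \<Longrightarrow> t i \<in> verts G" and "\<forall>i<m. \<exists>Y. Q t i Y"
      unfolding iff by blast
    then obtain Y where Y: "\<And>i. i < m \<Longrightarrow> Q t i (Y i)" by metis
    have sub: "component G (t i) \<subseteq> Y i" if "i < m" for i
      using Y[OF that] by (intro component_least) (auto simp: Q_def closed_set_def)
    have inj: "inj_on (\<lambda>i. component G (t i)) {..<m}"
    proof (rule inj_onI, rule ccontr)
      fix i j assume ij: "i \<in> {..<m}" "j \<in> {..<m}" "component G (t i) = component G (t j)" "i \<noteq> j"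
      then have "t j \<in> Y i" using sub[of i] component_self[of "t j" G] by auto
      then show False using Y[of i] ij by (auto simp: Q_def)
    qed
    have "(\<lambda>i. component G (t i)) ` {..<m} \<subseteq> small_components k G"
    proof (rule image_subsetI)
      fix i assume "i \<in> {..<m}"
      then have "Q t i (Y i)" "component G (t i) \<subseteq> Y i" "t i \<in> verts G" using Y sub t by auto
      then have "card (component G (t i)) \<le> card (Y i)" "card (Y i) \<le> k"
        using card_mono fin unfolding Q_def by blast+
      then show "component G (t i) \<in> small_components k G"
        using \<open>t i \<in> verts G\<close> by (simp add: small_components_def comp_sets_def)
    qed
    then show "m \<le> num_small k G"
      using card_mono[OF finite_small_components[OF G]] card_image[OF inj]
      unfolding num_small_def card_lessThan by metis
  next
    assume "m \<le> num_small k G"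
    then obtain f where f: "inj_on f {..<m}" "f ` {..<m} \<subseteq> small_components k G"
      using card_le_inj[of "{..<m}" "small_components k G"] finite_small_components[OF G]
      by (auto simp: num_small_def)
    define t where "t i = (SOME v. v \<in> f i)" for i
    have comp: "f i \<in> comp_sets G" "card (f i) \<le> k" if "i < m" for i
      using f(2) that by (auto simp: small_components_def)
    have t: "t i \<in> f i" if "i < m" for i
      unfolding t_def using components_nonempty[OF comp(1)[OF that]] by (auto intro: someI_ex)
    have sub: "f i \<subseteq> verts G" if "i < m" for i
      using components_subset_verts[OF G comp(1)[OF that]] .
    have "Q t i (f i)" if "i < m" for i
    proof -
      have "closed_set G (f i)"
        using comp(1)[OF that] component_closed[of _ G] by (auto simp: closed_set_def comp_sets_def)
      moreover have "t j \<notin> f i" if "j < m" "j \<noteq> i" for j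
        using components_disjoint[OF comp(1)[OF \<open>i < m\<close>] comp(1)[OF \<open>j < m\<close>]] t[OF \<open>j < m\<close>]
          f(1) that \<open>i < m\<close> by (auto dest: inj_onD)
      ultimately show ?thesis using comp(2) sub t that by (simp add: Q_def)
    qed
    then show "G \<Turnstile> many_small k m" unfolding iff using t sub by blast
  qed
qed

section \<open>Poisson distributions with large mean\<close>

definition poisson :: "real \<Rightarrow> nat \<Rightarrow> real" where
  "poisson l m = exp (- l) * l ^ m / fact m"

lemma poisson_nonneg: "0 \<le> l \<Longrightarrow> 0 \<le> poisson l m"
  by (simp add: poisson_def)

lemma poisson_Suc: "poisson l (Suc m) = poisson l m * l / real (Suc m)"
  by (simp add: poisson_def field_simps)

lemma poisson_sums: "poisson l sums 1"
proof -
  have "(\<lambda>m. exp (- l) * (l ^ m /\<^sub>R fact m)) sums (exp (- l) * exp l)"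
    by (intro sums_mult exp_converges)
  then show ?thesis by (simp add: poisson_def[abs_def] field_simps flip: exp_add)
qed

lemma poisson_sum_le_1:
  assumes "0 \<le> l" "finite A"
  shows "sum (poisson l) A \<le> 1"
  using sum_le_suminf[of "poisson l" A] poisson_sums[of l] poisson_nonneg[OF assms(1)] assms(2)
  by (auto simp: sums_iff)

lemma poisson_antimono:
  assumes "0 \<le> l" "l \<le> real (Suc a)" "a \<le> b"
  shows "poisson l b \<le> poisson l a"
  using assms(3)
proof (induction b rule: dec_induct)
  case (step n)
  have "poisson l (Suc n) = poisson l n * (l / real (Suc n))" by (simp add: poisson_Suc)
  also have "\<dots> \<le> poisson l n * 1"
    using assms step by (intro mult_left_mono poisson_nonneg) (auto simp: divide_le_eq)
  finally show ?case using step by simp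
qed simp

text \<open>Below the mode, the atoms following \<open>m\<close> are hardly smaller than the atom at \<open>m\<close>, and
  altogether they have mass at most one.\<close>

lemma poisson_shift:
  assumes "0 < l" "real m \<le> l" "i \<le> n"
  shows "poisson l m * (l / (l + real n)) ^ i \<le> poisson l (m + i)"
  using assms(3)
proof (induction i)
  case (Suc i)
  have "poisson l m * (l / (l + real n)) ^ Suc i = (poisson l m * (l / (l + real n)) ^ i) * (l / (l + real n))"
    by simp
  also have "\<dots> \<le> poisson l (m + i) * (l / (l + real n))"
    using Suc assms by (intro mult_right_mono) auto
  also have "\<dots> \<le> poisson l (m + i) * (l / real (Suc (m + i)))"
    using Suc.prems assms by (intro mult_left_mono divide_left_mono poisson_nonneg) auto
  also have "\<dots> = poisson l (m + Suc i)" by (simp add: poisson_Suc)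
  finally show ?case .
qed simp

text \<open>The \<open>n\<close> atoms starting at \<open>m\<close> are each at least the atom at
  \<open>m\<close> times the power, and together they have mass at most one. Atoms beyond the mean
  are dominated by the one at its integer part.\<close>

lemma poisson_le_mode:
  assumes "0 < l"
  shows "poisson l m * real n * (l / (l + real n)) ^ n \<le> 1"
proof -
  have *: "poisson l m * real n * (l / (l + real n)) ^ n \<le> 1" if "real m \<le> l" for m
  proof -
    have "poisson l m * real n * (l / (l + real n)) ^ n = (\<Sum>i<n. poisson l m * (l / (l + real n)) ^ n)"
      by simp
    also have "\<dots> \<le> (\<Sum>i<n. poisson l (m + i))"
    proof (rule sum_mono)
      fix i assume i: "i \<in> {..<n}"
      have "(l / (l + real n)) ^ n \<le> (l / (l + real n)) ^ i"
        using i assms by (intro power_decreasing) auto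
      then have "poisson l m * (l / (l + real n)) ^ n \<le> poisson l m * (l / (l + real n)) ^ i"
        using assms by (intro mult_left_mono poisson_nonneg) auto
      also have "\<dots> \<le> poisson l (m + i)" using poisson_shift[OF assms that] i by auto
      finally show "poisson l m * (l / (l + real n)) ^ n \<le> poisson l (m + i)" .
    qed
    also have "\<dots> = sum (poisson l) ((+) m ` {..<n})" by (simp add: sum.reindex)
    also have "\<dots> \<le> 1" using assms by (intro poisson_sum_le_1) auto
    finally show ?thesis .
  qed
  show ?thesis
  proof (cases "real m \<le> l")
    case False
    define a where "a = nat \<lfloor>l\<rfloor>"
    have a: "real a \<le> l" "l \<le> real (Suc a)" using assms unfolding a_def by linarith+
    have "poisson l m \<le> poisson l a" using a assms False by (intro poisson_antimono) linarith+
    then have "poisson l m * (real n * (l / (l + real n)) ^ n) \<le> poisson l a * (real n * (l / (l + real n)) ^ n)"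
      using assms by (intro mult_right_mono) auto
    then show ?thesis using *[OF a(1)] by (simp add: mult.assoc)
  qed (use * in simp)
qed

lemma poisson_atoms_small:
  assumes "0 < e"
  shows "\<forall>\<^sub>F l in at_top. \<forall>m. poisson l m < e"
proof -
  \<comment> \<open>\<open>n\<close> is fixed before \<open>l\<close>: once \<open>l\<close> is so
    large that the power exceeds 1/2, every atom is at most 2/n, which is below
    \<open>e\<close>.\<close>
  obtain n :: nat where n: "1 / e < real n / 2" using reals_Archimedean2[of "2 / e"] by (auto simp: field_simps)
  have "((\<lambda>l::real. (l / (l + real n)) ^ n) \<longlongrightarrow> 1 ^ n) at_top"
    by (intro tendsto_power) real_asymp
  then have "\<forall>\<^sub>F l in at_top. 1 / 2 < (l / (l + real n)) ^ n"
    by (rule order_tendstoD) simp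
  then show ?thesis using eventually_gt_at_top[of 0]
  proof eventually_elim
    case (elim l)
    show ?case
    proof
      fix m
      show "poisson l m < e"
      proof (cases "poisson l m = 0")
        case False
        then have p: "0 < poisson l m" using poisson_nonneg[of l m] elim by linarith
        have "poisson l m * (1 / e) < poisson l m * (real n / 2)"
          using n p by (intro mult_strict_left_mono) auto
        also have "\<dots> = poisson l m * real n * (1 / 2)" by simp
        also have "\<dots> \<le> poisson l m * real n * (l / (l + real n)) ^ n"
          using elim p by (intro mult_left_mono) auto
        also have "\<dots> \<le> 1" using elim by (intro poisson_le_mode)
        finally show ?thesis using \<open>0 < e\<close> by (simp add: field_simps)
      qed (use \<open>0 < e\<close> in simp)
    qed
  qed
qed

text \<open>For a single \<open>k\<close> with all atoms below \<open>e\<close>, the distribution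
  function climbs to 1 in steps shorter than \<open>e\<close>, so its first value above
  \<open>t\<close> overshoots by less than \<open>e\<close>.\<close>

lemma poisson_cdf_dense:
  assumes L: "filterlim L at_top sequentially"
  shows "closure (range (\<lambda>(k, m). \<Sum>i\<le>m. poisson (L k) i)) \<supseteq> {0..1}"
proof -
  let ?S = "range (\<lambda>(k, m). \<Sum>i\<le>m. poisson (L k) i)"
  \<comment> \<open>A value above \<open>t\<close> exists only for \<open>t < 1\<close>; the
    endpoint is recovered because the closure is closed.\<close>
  have "{0..<1} \<subseteq> closure ?S"
  proof
    fix t :: real assume t: "t \<in> {0..<1}"
    show "t \<in> closure ?S" unfolding closure_approachable
    proof (intro allI impI)
      fix e :: real assume "0 < e"
      have "\<forall>\<^sub>F k in sequentially. \<forall>m. poisson (L k) m < e"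
        using poisson_atoms_small[OF \<open>0 < e\<close>] L by (rule eventually_compose_filterlim)
      then obtain k where k: "\<And>m. poisson (L k) m < e"
        unfolding eventually_sequentially by blast
      have "(\<lambda>m. \<Sum>i\<le>m. poisson (L k) i) \<longlonglongrightarrow> 1"
        using poisson_sums[of "L k"] by (simp add: sums_def_le)
      then have "\<forall>\<^sub>F m in sequentially. t < (\<Sum>i\<le>m. poisson (L k) i)"
        by (rule order_tendstoD) (use t in simp)
      then have ex: "\<exists>m. t < (\<Sum>i\<le>m. poisson (L k) i)" unfolding eventually_sequentially by blast
      define m where "m = (LEAST m. t < (\<Sum>i\<le>m. poisson (L k) i))"
      have m: "t < (\<Sum>i\<le>m. poisson (L k) i)" using LeastI_ex[OF ex] by (simp add: m_def)
      have "(\<Sum>i\<le>m. poisson (L k) i) - t \<le> poisson (L k) m"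
      proof (cases m)
        case 0
        then show ?thesis using t by simp
      next
        case (Suc m')
        then have "\<not> t < (\<Sum>i\<le>m'. poisson (L k) i)" unfolding m_def by (intro not_less_Least) simp
        then show ?thesis using Suc by simp
      qed
      then have "dist (\<Sum>i\<le>m. poisson (L k) i) t < e" using m k[of m] by (simp add: dist_real_def)
      then show "\<exists>y\<in>?S. dist y t < e" by force
    qed
  qed
  then have "closure {0..<1} \<subseteq> closure ?S" by (rule closure_minimal) simp
  then show ?thesis by (simp only: closure_atLeastLessThan zero_less_one)
qed

section \<open>Truncated inclusion-exclusion\<close>

lemma alternating_binomial_partial_sum:
  "(\<Sum>r\<le>R. (-1) ^ r * real (Suc m choose r)) = (-1) ^ R * real (m choose R)"
  by (induction R) (auto simp: algebra_simps)

text \<open>The truncation error of the inclusion-exclusion expansion of the indicator of zero.\<close>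

lemma bonferroni_bound:
  "\<bar>of_bool (m = 0) - (\<Sum>r\<le>R. (-1) ^ r * real (m choose r))\<bar> \<le> real (m choose R)"
proof (cases m)
  case 0
  have "(\<Sum>r\<le>R. (-1) ^ r * real (0 choose r)) = (\<Sum>r\<in>{0}. (-1) ^ r * real (0 choose r))"
    by (rule sum.mono_neutral_right) auto
  then show ?thesis using 0 by simp
next
  case (Suc n)
  have "n choose R \<le> Suc n choose R" by (rule binomial_right_mono) simp
  then show ?thesis using Suc alternating_binomial_partial_sum[of n R] by (simp add: abs_mult power_abs)
qed

section \<open>The limiting law of the number of small components\<close>

definition egf_coeff :: "nat graph set \<Rightarrow> nat \<Rightarrow> real" where
  "egf_coeff \<G> n = real (card (labelled \<G> n)) / fact n"

definition connected_coeff :: "nat graph set \<Rightarrow> nat \<Rightarrow> real" where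
  "connected_coeff \<G> j = real (card (connected_on \<G> {1..j})) / fact j"

text \<open>Coefficient of the exponential generating function in which a graph has weight
  \<open>F\<close> of its number of small components. Leaving \<open>F\<close> free lets one marking
  identity serve constants, binomial coefficients and indicators.\<close>

definition weighted_coeff :: "nat graph set \<Rightarrow> nat \<Rightarrow> (nat \<Rightarrow> real) \<Rightarrow> nat \<Rightarrow> real" where
  "weighted_coeff \<G> k F n = (\<Sum>G\<in>labelled \<G> n. F (num_small k G)) / fact n"

definition poisson_mean :: "nat graph set \<Rightarrow> real \<Rightarrow> nat \<Rightarrow> real" where
  "poisson_mean \<G> \<rho> k = (\<Sum>j\<le>k. connected_coeff \<G> j * \<rho> ^ j)"

lemma egf_coeff_nonneg: "0 \<le> egf_coeff \<G> n"
  by (simp add: egf_coeff_def)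

lemma connected_coeff_nonneg: "0 \<le> connected_coeff \<G> n"
  by (simp add: connected_coeff_def)

lemma weighted_coeff_nonneg: "(\<And>x. 0 \<le> F x) \<Longrightarrow> 0 \<le> weighted_coeff \<G> k F n"
  by (simp add: weighted_coeff_def sum_nonneg)

lemma poisson_mean_nonneg: "0 \<le> \<rho> \<Longrightarrow> 0 \<le> poisson_mean \<G> \<rho> k"
  by (simp add: poisson_mean_def sum_nonneg connected_coeff_nonneg)

lemma weighted_coeff_one: "weighted_coeff \<G> k (\<lambda>_. 1) n = egf_coeff \<G> n"
  by (simp add: weighted_coeff_def egf_coeff_def)

lemma weighted_coeff_cmult: "weighted_coeff \<G> k (\<lambda>x. a * F x) n = a * weighted_coeff \<G> k F n"
  by (simp add: weighted_coeff_def sum_distrib_left)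

lemma weighted_coeff_sum:
  "weighted_coeff \<G> k (\<lambda>x. \<Sum>i\<in>I. F i x) n = (\<Sum>i\<in>I. weighted_coeff \<G> k (F i) n)"
  unfolding weighted_coeff_def by (subst sum.swap) (rule sum_divide_distrib)

text \<open>In terms of generating functions: if \<open>P\<close> is the polynomial with coefficients
  \<open>connected_coeff \<G> j\<close> for \<open>j \<le> k\<close>, then marking a small component multiplies by \<open>P\<close>.\<close>

lemma weighted_coeff_mark:
  assumes "graph_class \<G>" "decomposable \<G>"
  shows "weighted_coeff \<G> k (\<lambda>x. real x * F (x - 1)) n =
    (\<Sum>j\<le>k. if j \<le> n then connected_coeff \<G> j * weighted_coeff \<G> k F (n - j) else 0)"
proof -
  have "real (n choose j) * real (card (connected_on \<G> {1..j})) *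
       (\<Sum>G\<in>labelled \<G> (n - j). F (num_small k G)) / fact n =
     (if j \<le> n then connected_coeff \<G> j * weighted_coeff \<G> k F (n - j) else 0)" for j
    by (simp add: connected_coeff_def weighted_coeff_def binomial_fact)
  then show ?thesis
    unfolding weighted_coeff_def[of \<G> k "\<lambda>x. real x * F (x - 1)"] sum_labelled_mark[OF assms]
    by (simp add: sum_divide_distrib)
qed

text \<open>A telescoping product of \<open>j\<close> consecutive quotients, each tending to \<rho>;
  the intermediate values cancel because they are eventually nonzero.\<close>

lemma ratio_limit:
  fixes g :: "nat \<Rightarrow> real"
  assumes nz: "\<forall>\<^sub>F n in sequentially. g n \<noteq> 0" and lim: "(\<lambda>n. g n / g (Suc n)) \<longlonglongrightarrow> \<rho>"
  shows "(\<lambda>n. g (n - j) / g n) \<longlonglongrightarrow> \<rho> ^ j"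
proof -
  have "(\<lambda>n. g n / g (n + j)) \<longlonglongrightarrow> \<rho> ^ j"
  proof (induction j)
    case 0
    have "\<forall>\<^sub>F n in sequentially. g n / g (n + 0) = 1" using nz by eventually_elim simp
    then show ?case by (simp add: tendsto_eventually)
  next
    case (Suc j)
    have "(\<lambda>n. g (n + j) / g (Suc (n + j))) \<longlonglongrightarrow> \<rho>"
      using LIMSEQ_ignore_initial_segment[OF lim, of j] by simp
    from tendsto_mult[OF this Suc]
    have "(\<lambda>n. g (n + j) / g (Suc (n + j)) * (g n / g (n + j))) \<longlonglongrightarrow> \<rho> ^ Suc j" by simp
    moreover have "\<forall>\<^sub>F n in sequentially. g (n + j) \<noteq> 0"
      using nz by (rule eventually_all_ge_at_top[THEN eventually_mono]) simp
    then have "\<forall>\<^sub>F n in sequentially. g (n + j) / g (Suc (n + j)) * (g n / g (n + j)) = g n / g (n + Suc j)"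
      by eventually_elim simp
    ultimately show ?case by (rule Lim_transform_eventually)
  qed
  then show ?thesis using LIMSEQ_offset[of "\<lambda>n. g (n - j) / g n" j] by simp
qed

lemma bounded_partial_sums_ennreal:
  fixes f :: "nat \<Rightarrow> real"
  assumes "\<And>n. 0 \<le> f n" "\<And>N. (\<Sum>n\<le>N. f n) \<le> B"
  shows "(\<Sum>n. ennreal (f n)) \<noteq> \<infinity>"
proof -
  have "(\<Sum>n. ennreal (f n)) \<le> ennreal B"
  proof (rule suminf_le_const)
    fix N
    have "(\<Sum>n<N. f n) \<le> (\<Sum>n\<le>N. f n)" using assms(1) by (intro sum_mono2) auto
    then have "(\<Sum>n<N. f n) \<le> B" using assms(2)[of N] by linarith
    then show "(\<Sum>n<N. ennreal (f n)) \<le> ennreal B" by (simp add: assms(1) ennreal_leI)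
  qed simp
  then show ?thesis using ennreal_less_top[of B] by (auto simp: top_unique)
qed

section \<open>Divergence of the Poisson means\<close>

locale decomposable_class =
  fixes \<G> :: "nat graph set" and \<rho> :: real
  assumes cls: "graph_class \<G>" and dec: "decomposable \<G>" and rho: "0 \<le> \<rho>"
begin

lemma simple: "G \<in> labelled \<G> n \<Longrightarrow> simple_graph G"
  using cls by (simp add: labelled_def graph_class_def)

lemma num_small_le: "G \<in> labelled \<G> n \<Longrightarrow> num_small k G \<le> n"
proof -
  assume G: "G \<in> labelled \<G> n"
  have "num_small k G \<le> card (comp_sets G)"
    unfolding num_small_def small_components_def
    by (intro card_mono finite_components simple[OF G]) auto
  also have "\<dots> \<le> card (verts G)"
    unfolding comp_sets_def using simple[OF G] by (intro card_image_le) (simp add: simple_graph_def)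
  finally show ?thesis using G by (simp add: labelled_def)
qed

text \<open>With \<open>n \<le> k\<close> every component is small, in particular the one containing
  vertex 1.\<close>

lemma num_small_pos:
  assumes G: "G \<in> labelled \<G> n" and "0 < n" "n \<le> k"
  shows "num_small k G \<noteq> 0"
proof -
  have v: "verts G = {1..n}" using G by (simp add: labelled_def)
  have "component G 1 \<subseteq> {1..n}"
    using component_subset_verts[OF simple[OF G], of 1] v \<open>0 < n\<close> by simp
  then have "card (component G 1) \<le> card {1..n}" by (intro card_mono) auto
  then have "component G 1 \<in> small_components k G"
    using v assms by (simp add: small_components_def comp_sets_def)
  then show ?thesis
    using finite_small_components[OF simple[OF G], of k] unfolding num_small_def by auto
qed

lemma egf_coeff_0_le: "egf_coeff \<G> 0 \<le> 1"
proof -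
  have "labelled \<G> 0 \<subseteq> {({}, {})}"
  proof
    fix G assume G: "G \<in> labelled \<G> 0"
    then have "verts G = {}" by (simp add: labelled_def)
    moreover have "edges G = {}"
      using simple[OF G] \<open>verts G = {}\<close> by (fastforce simp: simple_graph_def)
    ultimately show "G \<in> {({}, {})}" by (simp add: prod_eq_iff)
  qed
  then have "card (labelled \<G> 0) \<le> card {({}, {}) :: nat graph}" by (intro card_mono) auto
  then show ?thesis by (simp add: egf_coeff_def)
qed

text \<open>Shifting by \<open>j\<close> turns each inner sum into a part of the full partial sum of
  nonnegative terms. Partial sums are used throughout because the series itself may diverge at
  \<rho>.\<close>

lemma sum_weighted_coeff_mark_le:
  assumes F: "\<And>x. 0 \<le> F x"
  shows "(\<Sum>n\<le>N. weighted_coeff \<G> k (\<lambda>x. real x * F (x - 1)) n * \<rho> ^ n)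
    \<le> poisson_mean \<G> \<rho> k * (\<Sum>n\<le>N. weighted_coeff \<G> k F n * \<rho> ^ n)"
proof -
  define h where "h n = weighted_coeff \<G> k F n * \<rho> ^ n" for n
  have h: "0 \<le> h n" for n using rho weighted_coeff_nonneg[of F, OF F] by (simp add: h_def)
  have "(\<Sum>n\<le>N. weighted_coeff \<G> k (\<lambda>x. real x * F (x - 1)) n * \<rho> ^ n) =
     (\<Sum>n\<le>N. \<Sum>j\<le>k. connected_coeff \<G> j * \<rho> ^ j * (if j \<le> n then h (n - j) else 0))"
  proof (rule sum.cong[OF HOL.refl])
    fix n
    have "\<rho> ^ n = \<rho> ^ j * \<rho> ^ (n - j)" if "j \<le> n" for j
      using that by (simp flip: power_add)
    then show "weighted_coeff \<G> k (\<lambda>x. real x * F (x - 1)) n * \<rho> ^ n =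
      (\<Sum>j\<le>k. connected_coeff \<G> j * \<rho> ^ j * (if j \<le> n then h (n - j) else 0))"
      unfolding weighted_coeff_mark[OF cls dec] sum_distrib_right
      by (intro sum.cong HOL.refl) (simp add: h_def)
  qed
  also have "\<dots> = (\<Sum>j\<le>k. connected_coeff \<G> j * \<rho> ^ j * (\<Sum>n\<le>N. if j \<le> n then h (n - j) else 0))"
    by (subst sum.swap) (simp add: sum_distrib_left)
  also have "\<dots> \<le> (\<Sum>j\<le>k. connected_coeff \<G> j * \<rho> ^ j * (\<Sum>n\<le>N. h n))"
  proof (rule sum_mono, rule mult_left_mono)
    fix j
    have "(\<Sum>n\<le>N. if j \<le> n then h (n - j) else 0) = (\<Sum>n\<in>{j..N}. h (n - j))"
      by (rule sum.mono_neutral_cong_right) auto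
    also have "\<dots> = sum h ((\<lambda>n. n - j) ` {j..N})"
      by (subst sum.reindex) (auto simp: inj_on_def)
    also have "\<dots> \<le> (\<Sum>n\<le>N. h n)" using h by (intro sum_mono2) auto
    finally show "(\<Sum>n\<le>N. if j \<le> n then h (n - j) else 0) \<le> (\<Sum>n\<le>N. h n)" .
    show "0 \<le> connected_coeff \<G> j * \<rho> ^ j" using rho by (simp add: connected_coeff_nonneg)
  qed
  also have "\<dots> = poisson_mean \<G> \<rho> k * (\<Sum>n\<le>N. h n)"
    by (simp add: poisson_mean_def sum_distrib_right)
  finally show ?thesis by (simp add: h_def)
qed

text \<open>\<open>N\<close> is both the truncation of the sum and the size cutoff. Hence all
  components of the graphs counted are small, and for \<open>m = 0\<close> only the null graph
  contributes. The induction step marks one component.\<close>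

lemma sum_exactly_le:
  "(\<Sum>n\<le>N. weighted_coeff \<G> N (\<lambda>x. of_bool (x = m)) n * \<rho> ^ n) \<le> poisson_mean \<G> \<rho> N ^ m / fact m"
proof (induction m)
  case 0
  have "weighted_coeff \<G> N (\<lambda>x. of_bool (x = 0)) n * \<rho> ^ n \<le> of_bool (n = 0)" if "n \<le> N" for n
  proof (cases "n = 0")
    case True
    have "weighted_coeff \<G> N (\<lambda>x. of_bool (x = 0)) 0 \<le> weighted_coeff \<G> N (\<lambda>_. 1) 0"
      unfolding weighted_coeff_def by (intro divide_right_mono sum_mono) auto
    then show ?thesis using True egf_coeff_0_le by (simp add: weighted_coeff_one)
  next
    case False
    then have "weighted_coeff \<G> N (\<lambda>x. of_bool (x = 0)) n = 0"
      using num_small_pos[of _ n N] that by (auto simp: weighted_coeff_def intro!: sum.neutral)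
    then show ?thesis by simp
  qed
  then have "(\<Sum>n\<le>N. weighted_coeff \<G> N (\<lambda>x. of_bool (x = 0)) n * \<rho> ^ n) \<le> (\<Sum>n\<le>N. of_bool (n = 0))"
    by (intro sum_mono) auto
  also have "\<dots> = 1" by simp
  finally show ?case by simp
next
  case (Suc m)
  let ?F = "\<lambda>m x. of_bool (x = m) :: real"
  have eq: "(\<lambda>x. real x * ?F m (x - 1)) = (\<lambda>x. real (Suc m) * ?F (Suc m) x)"
  proof
    \<comment> \<open>At \<open>x = 0\<close> the truncated \<open>x - 1\<close> equals 0 and may
      coincide with \<open>m\<close>, but the factor \<open>real x\<close> removes this
      case.\<close>
    fix x show "real x * ?F m (x - 1) = real (Suc m) * ?F (Suc m) x" by (cases x) auto
  qed
  have "real (Suc m) * (\<Sum>n\<le>N. weighted_coeff \<G> N (?F (Suc m)) n * \<rho> ^ n) =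
     (\<Sum>n\<le>N. weighted_coeff \<G> N (\<lambda>x. real x * ?F m (x - 1)) n * \<rho> ^ n)"
    unfolding eq weighted_coeff_cmult by (simp add: sum_distrib_left mult.assoc)
  also have "\<dots> \<le> poisson_mean \<G> \<rho> N * (\<Sum>n\<le>N. weighted_coeff \<G> N (?F m) n * \<rho> ^ n)"
    by (rule sum_weighted_coeff_mark_le) simp
  also have "\<dots> \<le> poisson_mean \<G> \<rho> N * (poisson_mean \<G> \<rho> N ^ m / fact m)"
    by (intro mult_left_mono Suc poisson_mean_nonneg rho)
  also have "\<dots> = real (Suc m) * (poisson_mean \<G> \<rho> N ^ Suc m / fact (Suc m))" by simp
  finally show ?case by (simp only: mult_le_cancel_left_pos of_nat_0_less_iff zero_less_Suc)
qed

text \<open>Only the inequality of the exponential formula is needed here.\<close>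

lemma sum_egf_le_exp: "(\<Sum>n\<le>N. egf_coeff \<G> n * \<rho> ^ n) \<le> exp (poisson_mean \<G> \<rho> N)"
proof -
  have "egf_coeff \<G> n = (\<Sum>m\<le>N. weighted_coeff \<G> N (\<lambda>x. of_bool (x = m)) n)" if "n \<le> N" for n
  proof -
    \<comment> \<open>A graph on at most \<open>N\<close> vertices has at most \<open>N\<close>
      components, so exactly one \<open>m\<close> matches.\<close>
    have "(\<Sum>m\<le>N. of_bool (num_small N G = m)) = (1::real)" if "G \<in> labelled \<G> n" for G
      using num_small_le[OF that, of N] \<open>n \<le> N\<close> by (simp add: of_bool_def)
    then have "weighted_coeff \<G> N (\<lambda>x. \<Sum>m\<le>N. of_bool (x = m)) n = weighted_coeff \<G> N (\<lambda>_. 1) n"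
      unfolding weighted_coeff_def by (intro arg_cong2[where f = "(/)"] sum.cong HOL.refl)
    then show ?thesis by (simp only: weighted_coeff_sum weighted_coeff_one)
  qed
  then have "(\<Sum>n\<le>N. egf_coeff \<G> n * \<rho> ^ n) =
      (\<Sum>n\<le>N. \<Sum>m\<le>N. weighted_coeff \<G> N (\<lambda>x. of_bool (x = m)) n * \<rho> ^ n)"
    by (simp add: sum_distrib_right)
  also have "\<dots> = (\<Sum>m\<le>N. \<Sum>n\<le>N. weighted_coeff \<G> N (\<lambda>x. of_bool (x = m)) n * \<rho> ^ n)"
    by (rule sum.swap)
  also have "\<dots> \<le> (\<Sum>m\<le>N. poisson_mean \<G> \<rho> N ^ m / fact m)"
    by (intro sum_mono sum_exactly_le)
  also have "\<dots> \<le> (\<Sum>m. poisson_mean \<G> \<rho> N ^ m / fact m)"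
    using summable_exp_generic[of "poisson_mean \<G> \<rho> N"]
    by (intro sum_le_suminf) (auto simp: divide_inverse_commute poisson_mean_nonneg rho)
  also have "\<dots> = exp (poisson_mean \<G> \<rho> N)"
    by (simp add: exp_def divide_inverse_commute)
  finally show ?thesis .
qed

lemma poisson_mean_at_top:
  assumes "(\<Sum>n. ennreal (egf_coeff \<G> n * \<rho> ^ n)) = \<infinity>"
  shows "filterlim (poisson_mean \<G> \<rho>) at_top sequentially"
  unfolding filterlim_at_top
proof
  fix Z
  have "\<exists>N. Z \<le> poisson_mean \<G> \<rho> N"
  proof (rule ccontr)
    assume "\<not> ?thesis"
    then have "exp (poisson_mean \<G> \<rho> N) \<le> exp Z" for N by (simp add: not_le less_imp_le)
    then have bound: "(\<Sum>n\<le>N. egf_coeff \<G> n * \<rho> ^ n) \<le> exp Z" for N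
      by (rule order_trans[OF sum_egf_le_exp])
    have "(\<Sum>n. ennreal (egf_coeff \<G> n * \<rho> ^ n)) \<noteq> \<infinity>"
      by (rule bounded_partial_sums_ennreal[OF _ bound]) (simp add: egf_coeff_nonneg rho)
    with assms show False by contradiction
  qed
  then obtain N where N: "Z \<le> poisson_mean \<G> \<rho> N" ..
  have "poisson_mean \<G> \<rho> N \<le> poisson_mean \<G> \<rho> k" if "N \<le> k" for k
    unfolding poisson_mean_def
    using that rho by (intro sum_mono2) (auto simp: connected_coeff_nonneg)
  with N show "\<forall>\<^sub>F k in sequentially. Z \<le> poisson_mean \<G> \<rho> k"
    unfolding eventually_sequentially using order_trans[OF N] by blast
qed

end

section \<open>Convergence to the Poisson law under smoothness\<close>

locale smooth_class = decomposable_class +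
  assumes nonzero: "\<forall>\<^sub>F n in sequentially. egf_coeff \<G> n \<noteq> 0"
    and ratio: "(\<lambda>n. egf_coeff \<G> n / egf_coeff \<G> (Suc n)) \<longlonglongrightarrow> \<rho>"
begin

text \<open>Whenever there are members on \<open>n\<close> vertices, this is the mean of
  \<open>F\<close> of the number of small components under the uniform distribution, the factorials
  cancelling.\<close>

definition expect :: "nat \<Rightarrow> (nat \<Rightarrow> real) \<Rightarrow> nat \<Rightarrow> real" where
  "expect k F n = weighted_coeff \<G> k F n / egf_coeff \<G> n"

text \<open>In the marking identity divided by \<open>egf_coeff \<G> n\<close>, the term for
  \<open>j\<close> is the connected coefficient times a coefficient quotient tending to
  \<open>\<rho> ^ j\<close> times an expectation at \<open>n - j\<close> tending to
  \<open>l\<close>.\<close>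

lemma expect_mark:
  assumes lim: "expect k F \<longlonglongrightarrow> l"
  shows "expect k (\<lambda>x. real x * F (x - 1)) \<longlonglongrightarrow> poisson_mean \<G> \<rho> k * l"
proof -
  have shift: "(\<lambda>n. expect k F (n - j)) \<longlonglongrightarrow> l" for j
    using lim LIMSEQ_offset[of "\<lambda>n. expect k F (n - j)" j] by simp
  \<comment> \<open>Expanding each term through \<open>expect k F (n - j)\<close> divides by these
    coefficients as well.\<close>
  have nz: "\<forall>\<^sub>F n in sequentially. \<forall>j\<le>k. egf_coeff \<G> (n - j) \<noteq> 0"
  proof -
    obtain N where "\<And>n. N \<le> n \<Longrightarrow> egf_coeff \<G> n \<noteq> 0"
      using nonzero unfolding eventually_sequentially by blast
    then have "\<forall>n\<ge>N + k. \<forall>j\<le>k. egf_coeff \<G> (n - j) \<noteq> 0" by simp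
    then show ?thesis unfolding eventually_sequentially by blast
  qed
  have "(\<lambda>n. \<Sum>j\<le>k. connected_coeff \<G> j * (egf_coeff \<G> (n - j) / egf_coeff \<G> n) * expect k F (n - j))
      \<longlonglongrightarrow> (\<Sum>j\<le>k. connected_coeff \<G> j * \<rho> ^ j * l)"
    by (intro tendsto_intros ratio_limit nonzero ratio shift)
  then have "(\<lambda>n. \<Sum>j\<le>k. connected_coeff \<G> j * (egf_coeff \<G> (n - j) / egf_coeff \<G> n) * expect k F (n - j))
      \<longlonglongrightarrow> poisson_mean \<G> \<rho> k * l"
    by (simp add: poisson_mean_def sum_distrib_right)
  moreover have "\<forall>\<^sub>F n in sequentially.
     (\<Sum>j\<le>k. connected_coeff \<G> j * (egf_coeff \<G> (n - j) / egf_coeff \<G> n) * expect k F (n - j)) =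
     expect k (\<lambda>x. real x * F (x - 1)) n"
    using nz eventually_ge_at_top[of k]
  proof eventually_elim
    case (elim n)
    then show ?case
      unfolding expect_def weighted_coeff_mark[OF cls dec] sum_divide_distrib
      by (intro sum.cong HOL.refl) auto
  qed
  ultimately show ?thesis by (rule Lim_transform_eventually)
qed

lemma expect_cmult: "expect k (\<lambda>x. a * F x) n = a * expect k F n"
  by (simp add: expect_def weighted_coeff_cmult)

lemma expect_sum: "expect k (\<lambda>x. \<Sum>i\<in>I. F i x) n = (\<Sum>i\<in>I. expect k (F i) n)"
  by (simp add: expect_def weighted_coeff_sum sum_divide_distrib)

lemma expect_one: "expect k (\<lambda>_. 1) \<longlonglongrightarrow> 1"
proof (rule tendsto_eventually)
  show "\<forall>\<^sub>F n in sequentially. expect k (\<lambda>_. 1) n = 1"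
    using nonzero by eventually_elim (simp add: expect_def weighted_coeff_one)
qed

text \<open>The absorption identity for binomial coefficients makes each moment the marked version
  of the previous one.\<close>

lemma expect_binomial:
  "expect k (\<lambda>x. real (x choose r)) \<longlonglongrightarrow> poisson_mean \<G> \<rho> k ^ r / fact r"
proof (induction r)
  case 0
  then show ?case using expect_one by simp
next
  case (Suc r)
  have "(\<lambda>x. real x * real (x - 1 choose r)) = (\<lambda>x. real (Suc r) * real (x choose Suc r))"
  proof
    fix x
    have "x * (x - 1 choose r) = Suc r * (x choose Suc r)"
      using times_binomial_minus1_eq[of "Suc r" x] by simp
    then show "real x * real (x - 1 choose r) = real (Suc r) * real (x choose Suc r)"
      by (metis of_nat_mult)
  qed
  then have "(\<lambda>n. real (Suc r) * expect k (\<lambda>x. real (x choose Suc r)) n)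
      \<longlonglongrightarrow> poisson_mean \<G> \<rho> k * (poisson_mean \<G> \<rho> k ^ r / fact r)"
    using expect_mark[OF Suc] by (simp add: expect_cmult[abs_def])
  from tendsto_mult[OF tendsto_const[of "inverse (real (Suc r))"] this]
  show ?case by (simp add: field_simps del: of_nat_Suc)
qed

lemma abs_expect_le:
  assumes "\<And>x. \<bar>F x\<bar> \<le> H x"
  shows "\<bar>expect k F n\<bar> \<le> expect k H n"
proof -
  have "\<bar>\<Sum>G\<in>labelled \<G> n. F (num_small k G)\<bar> \<le> (\<Sum>G\<in>labelled \<G> n. H (num_small k G))"
    by (rule order_trans[OF sum_abs]) (intro sum_mono assms)
  then show ?thesis
    by (simp add: expect_def weighted_coeff_def divide_right_mono egf_coeff_nonneg)
qed

lemma expect_bonferroni: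
  "\<bar>expect k (\<lambda>x. of_bool (x = 0)) n - (\<Sum>r\<le>R. (-1) ^ r * expect k (\<lambda>x. real (x choose r)) n)\<bar>
    \<le> expect k (\<lambda>x. real (x choose R)) n"
proof -
  have *: "expect k (\<lambda>x. of_bool (x = 0)) n - (\<Sum>r\<le>R. (-1) ^ r * expect k (\<lambda>x. real (x choose r)) n) =
    expect k (\<lambda>x. of_bool (x = 0) - (\<Sum>r\<le>R. (-1) ^ r * real (x choose r))) n"
    unfolding expect_cmult[symmetric] expect_sum[symmetric]
    by (simp add: expect_def weighted_coeff_def sum_subtractf diff_divide_distrib)
  show ?thesis
    unfolding * by (intro abs_expect_le bonferroni_bound)
qed

lemma expect_zero: "expect k (\<lambda>x. of_bool (x = 0)) \<longlonglongrightarrow> exp (- poisson_mean \<G> \<rho> k)"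
proof (rule tendstoI)
  fix e :: real assume "0 < e"
  define l where "l = poisson_mean \<G> \<rho> k"
  define p where "p R = (\<Sum>r\<le>R. (-1) ^ r * (l ^ r / fact r))" for R
  have "(\<lambda>r. (-l) ^ r /\<^sub>R fact r) = (\<lambda>r. (-1) ^ r * (l ^ r / fact r))"
    by (auto simp: fun_eq_iff power_minus[of l] field_simps)
  then have "(\<lambda>r. (-1) ^ r * (l ^ r / fact r)) sums exp (- l)"
    using exp_converges[of "-l"] by simp
  then have "p \<longlonglongrightarrow> exp (- l)" unfolding p_def[abs_def] by (simp add: sums_def_le)
  then have ev1: "\<forall>\<^sub>F R in sequentially. dist (p R) (exp (- l)) < e / 3"
    using \<open>0 < e\<close> by (intro tendstoD) auto
  have "(\<lambda>R. l ^ R / fact R) \<longlonglongrightarrow> 0"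
    using summable_LIMSEQ_zero[OF summable_exp[of l]] by (simp add: field_simps)
  then have ev2: "\<forall>\<^sub>F R in sequentially. l ^ R / fact R < e / 3"
    using \<open>0 < e\<close> by (intro order_tendstoD) auto
  \<comment> \<open>\<open>R\<close> is chosen before \<open>n\<close>, from the limits alone: it
    controls both the tail of the exponential series and the limit of the Bonferroni error.
    Convergence in \<open>n\<close> is then needed for finitely many moments.\<close>
  obtain R where R: "dist (p R) (exp (- l)) < e / 3" "l ^ R / fact R < e / 3"
    using eventually_happens'[OF _ eventually_conj[OF ev1 ev2]] by auto
  have "(\<lambda>n. \<Sum>r\<le>R. (-1) ^ r * expect k (\<lambda>x. real (x choose r)) n) \<longlonglongrightarrow> p R"
    unfolding p_def l_def by (intro tendsto_intros expect_binomial)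
  then have "\<forall>\<^sub>F n in sequentially. dist (\<Sum>r\<le>R. (-1) ^ r * expect k (\<lambda>x. real (x choose r)) n) (p R) < e / 3"
    using \<open>0 < e\<close> by (intro tendstoD) auto
  moreover have "\<forall>\<^sub>F n in sequentially. expect k (\<lambda>x. real (x choose R)) n < e / 3"
    using expect_binomial[of k R] R(2) unfolding l_def by (rule order_tendstoD)
  ultimately show "\<forall>\<^sub>F n in sequentially. dist (expect k (\<lambda>x. of_bool (x = 0)) n) (exp (- poisson_mean \<G> \<rho> k)) < e"
    unfolding l_def[symmetric]
  proof eventually_elim
    case (elim n)
    then show ?case using R(1) expect_bonferroni[of k n R] unfolding dist_real_def by linarith
  qed
qed

text \<open>Marking reproduces in the limit the recursion \<open>poisson_Suc\<close> between
  neighbouring atoms, so convergence at zero propagates to all \<open>m\<close>.\<close>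

lemma expect_exactly: "expect k (\<lambda>x. of_bool (x = m)) \<longlonglongrightarrow> poisson (poisson_mean \<G> \<rho> k) m"
proof (induction m)
  case 0
  then show ?case using expect_zero by (simp add: poisson_def)
next
  case (Suc m)
  let ?F = "\<lambda>m x. of_bool (x = m) :: real"
  have "(\<lambda>x. real x * ?F m (x - 1)) = (\<lambda>x. real (Suc m) * ?F (Suc m) x)"
  proof
    fix x show "real x * ?F m (x - 1) = real (Suc m) * ?F (Suc m) x" by (cases x) auto
  qed
  then have "(\<lambda>n. real (Suc m) * expect k (?F (Suc m)) n)
      \<longlonglongrightarrow> poisson_mean \<G> \<rho> k * poisson (poisson_mean \<G> \<rho> k) m"
    using expect_mark[OF Suc] by (simp add: expect_cmult[abs_def])
  from tendsto_mult[OF tendsto_const[of "inverse (real (Suc m))"] this]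
  show ?case by (simp add: poisson_Suc field_simps del: of_nat_Suc)
qed

lemma expect_at_most:
  "expect k (\<lambda>x. of_bool (x \<le> m)) \<longlonglongrightarrow> (\<Sum>i\<le>m. poisson (poisson_mean \<G> \<rho> k) i)"
proof -
  have eq: "(\<lambda>x. of_bool (x \<le> m)) = (\<lambda>x. \<Sum>i\<le>m. of_bool (x = i) :: real)"
    by (simp add: fun_eq_iff of_bool_def)
  have "(\<lambda>n. \<Sum>i\<le>m. expect k (\<lambda>x. of_bool (x = i)) n)
      \<longlonglongrightarrow> (\<Sum>i\<le>m. poisson (poisson_mean \<G> \<rho> k) i)"
    by (intro tendsto_sum expect_exactly)
  then show ?thesis unfolding eq expect_sum[symmetric] .
qed

end

theorem theorem5p4:
  fixes \<G> :: "nat graph set" and \<rho> :: real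
  assumes "graph_class \<G>"
    and "decomposable \<G>"
    and "smooth \<G>"
    and "minor_closed \<G>"
    and "fps_conv_radius (egf \<G>) = ereal \<rho>"
    and "(\<Sum>n. ennreal (fps_nth (egf \<G>) n * \<rho> ^ n)) = \<infinity>"
  shows "\<exists>\<Phi>. (\<forall>\<phi>\<in>\<Phi>. sentence \<phi> \<and> convergent (prob_models \<G> \<phi>)) \<and>
              closure ((\<lambda>\<phi>. lim (prob_models \<G> \<phi>)) ` \<Phi>) = {0..1}"
proof -
  let ?g = "egf_coeff \<G>"
  have nth: "fps_nth (egf \<G>) = ?g" by (simp add: egf_def egf_coeff_def fun_eq_iff)
  obtain r where nz: "\<forall>\<^sub>F n in sequentially. ?g n \<noteq> 0"
    and r: "(\<lambda>n. real n * real (card (labelled \<G> (n - 1))) / real (card (labelled \<G> n))) \<longlonglongrightarrow> r"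
    using assms(3) by (auto simp: smooth_def convergent_def egf_coeff_def)
  have "real (Suc n) * real (card (labelled \<G> n)) / real (card (labelled \<G> (Suc n))) = ?g n / ?g (Suc n)" for n
    by (simp add: egf_coeff_def)
  then have ratio: "(\<lambda>n. ?g n / ?g (Suc n)) \<longlonglongrightarrow> r"
    using LIMSEQ_Suc[OF r] by simp
  \<comment> \<open>The factorials absorb the factor \<open>n\<close> of the smoothness quotient, so
    its limit is also the limit in the ratio test and must be the given radius.\<close>
  have "conv_radius ?g = ereal r"
    by (rule conv_radius_ratio_limit[OF HOL.refl nz]) (use ratio in \<open>simp add: egf_coeff_nonneg\<close>)
  then have "r = \<rho>" using assms(5) by (simp add: fps_conv_radius_def nth)
  have "0 \<le> r" by (rule LIMSEQ_le_const[OF ratio]) (simp add: egf_coeff_nonneg)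
  interpret smooth_class \<G> \<rho>
    using assms(1,2) \<open>0 \<le> r\<close> nz ratio unfolding \<open>r = \<rho>\<close> by unfold_locales
  \<comment> \<open>Negating "at least \<open>Suc m\<close>" gives "at most \<open>m\<close>", so
    the limiting probabilities are values of Poisson distribution functions.\<close>
  define \<phi> where "\<phi> = (\<lambda>(k, m). Neg (many_small k (Suc m)))"
  define cdf where "cdf = (\<lambda>(k, m). \<Sum>i\<le>m. poisson (poisson_mean \<G> \<rho> k) i)"
  have sentence: "sentence (\<phi> p)" for p
    using sentence_many_small by (simp add: \<phi>_def sentence_def split: prod.split)
  have lim: "prob_models \<G> (\<phi> p) \<longlonglongrightarrow> cdf p" for p
  proof -
    obtain k m where p: "p = (k, m)" by (cases p)
    have sat: "G \<Turnstile> \<phi> p \<longleftrightarrow> num_small k G \<le> m" if "G \<in> labelled \<G> n" for G n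
      using models_sentence[OF sentence, of G p undefined] many_small_iff[OF simple[OF that], of k "Suc m"]
        models_sentence[OF sentence_many_small, of G k "Suc m" undefined]
      by (auto simp: \<phi>_def p)
    \<comment> \<open>\<open>pmf_of_set\<close> is uniform only on a nonempty finite set, so the
      identity is claimed where the coefficient is nonzero, which holds eventually.\<close>
    have eq: "prob_models \<G> (\<phi> p) n = expect k (\<lambda>x. of_bool (x \<le> m)) n" if "?g n \<noteq> 0" for n
    proof -
      have fin: "finite (labelled \<G> n)" by (rule finite_labelled[OF cls])
      have "labelled \<G> n \<noteq> {}" using that by (auto simp: egf_coeff_def)
      then have "prob_models \<G> (\<phi> p) n = real (card (labelled \<G> n \<inter> {G. G \<Turnstile> \<phi> p})) / real (card (labelled \<G> n))"
        using fin by (simp add: prob_models_def measure_pmf_of_set)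
      also have "labelled \<G> n \<inter> {G. G \<Turnstile> \<phi> p} = labelled \<G> n \<inter> {G. num_small k G \<le> m}"
        using sat by blast
      also have "real (card (labelled \<G> n \<inter> {G. num_small k G \<le> m})) = (\<Sum>G\<in>labelled \<G> n. of_bool (num_small k G \<le> m))"
        using fin by simp
      finally show ?thesis by (simp add: expect_def weighted_coeff_def egf_coeff_def)
    qed
    have "\<forall>\<^sub>F n in sequentially. expect k (\<lambda>x. of_bool (x \<le> m)) n = prob_models \<G> (\<phi> p) n"
      using nonzero by (rule eventually_mono) (simp add: eq)
    with expect_at_most[of k m] show ?thesis
      unfolding cdf_def p prod.case by (rule Lim_transform_eventually)
  qed
  have range: "(\<lambda>\<psi>. lim (prob_models \<G> \<psi>)) ` range \<phi> = range cdf"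
    using limI[OF lim] by (simp add: image_image)
  have "cdf p \<in> {0..1}" for p
    using poisson_mean_nonneg[OF rho, of \<G>] poisson_sum_le_1
    by (auto simp: cdf_def sum_nonneg poisson_nonneg split: prod.split)
  then have "closure (range cdf) \<subseteq> {0..1}" by (intro closure_minimal) auto
  moreover have "{0..1} \<subseteq> closure (range cdf)"
    unfolding cdf_def using poisson_mean_at_top assms(6) by (intro poisson_cdf_dense) (simp add: nth)
  ultimately have "closure ((\<lambda>\<psi>. lim (prob_models \<G> \<psi>)) ` range \<phi>) = {0..1}"
    unfolding range by blast
  moreover have "\<forall>\<psi>\<in>range \<phi>. sentence \<psi> \<and> convergent (prob_models \<G> \<psi>)"
    using sentence convergentI[OF lim] by blast
  ultimately show ?thesis by blast
qed

end
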